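(* (Batch means.) Let $Z_1$ satisfy the marginal limit condition with parameters $(\mu,h,\ell,Y_1)$ (defined in the context). Fix an integer $m\ge2$, put $Z_{1,k}^{\mathrm{bm}}(t)=Z_1(\frac kmt)-Z_1(\frac{k-1}mt)$ for $1\le k\le m$, and define $$Z_1^{\mathrm{bm}}(t)=Z_1(t),\qquad Z_2^{*,\mathrm{bm}}(t)=\frac1{m-1}\sum_{k=1}^m\frac1t\int_0^t\Big(Z_{1,k}^{\mathrm{bm}}(s)-\frac1mZ_1(s)\Big)^2ds,$$ $$Y_1^{\mathrm{bm}}(t)=Y_1(t),\qquad Y_2^{*,\mathrm{bm}}(t)=\frac1{m-1}\sum_{k=1}^m\frac1t\int_0^t\Big(Y_1\big(\tfrac kms\big)-Y_1\big(\tfrac{k-1}ms\big)-\frac1mY_1(s)\Big)^2ds,$$ for $t>0$, where the time-averaged processes $Z_2^{*,\mathrm{bm}},Y_2^{*,\mathrm{bm}}$ are defined to be zero at time zero. Suppose that $\mathbb P(Y_2^{*,\mathrm{bm}}(1)>0)=1$. Then, as $\varepsilon\to0^+$, $$\Big(\varepsilon^h\ell(\varepsilon^{-1})\big(Z_1^{\mathrm{bm}}(\tfrac{\cdot}{\varepsilon})-\tfrac{\cdot}{\varepsilon}\mu\big),\ \varepsilon^h\ell(\varepsilon^{-1})\sqrt{Z_2^{*,\mathrm{bm}}(\tfrac{\cdot}{\varepsilon})}\Big)\Rightarrow\Big(Y_1^{\mathrm{bm}}(\cdot),\sqrt{Y_2^{*,\mathrm{bm}}(\cdot)}\Big)\quad\text{weakly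 in }\mathrm{WM}_2,$$ the process $Y_2^{*,\mathrm{bm}}$ is continuous, and the pair $(Z_1^{\mathrm{bm}},Z_2^{*,\mathrm{bm}})$ satisfies the functional limit condition with parameters $(\mu,h,\ell,Y_1^{\mathrm{bm}},Y_2^{*,\mathrm{bm}})$.
   Context: Topologies. Write $\mathbb D=D([0,\infty),\mathbb R)$ and $\mathbb D_+=D([0,\infty),\mathbb R_+)$ for càdlàg paths. For a càdlàg $x$ on $[0,T]$, its completed graph is $\Gamma_x=\{(t,z): t\in[0,T],\ z$ between $x(t-)$ and $x(t)$ inclusive$\}$, with $x(0-):=x(0)$. The $M_2$ topology on $D([0,T],\mathbb R)$ is induced by the Hausdorff distance between completed graphs. Convergence on $[0,\infty)$ means convergence of the restrictions to $[0,T]$ for every continuity point $T$ of the limit. $\mathrm{WM}_2$ denotes the product of the univariate $M_2$ topologies over the two coordinates. Quasi-left-continuity. A càdlàg process $Y$ is quasi-left-continuous with respect to a filtration if $\mathbb P(\Delta Y(\tau)=0)=1$ for every finite predictable stopping time $\tau$ of that filtration. Augmented natural filtration means the usual augmentation of the natural filtration. Marginal limit condition with parameters $(\mu,h,\ell,Y_1)$. $Z_1$ has sample paths in $\mathbb D$ with $Z_1(0)=0$ a.s.; $\mu\in\mathbb R$; $0<h<1$; $\ell$ is an eventually positive function slowly varying at infinity; $Y_1\in\mathbb D$ is a process such that $\varepsilon^h\ell(\varepsilon^{-1})(Z_1(\tfrac{\cdot}{\varepsilon})-\tfrac{\cdot}{\varepsilon}\mu)\Rightarrow Y_1(\cdot)$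 weakly in $M_2$ as $\varepsilon\to0^+$; $(Z_1(t)-\mu t)/t\to0$ a.s. as $t\to\infty$; $Y_1(a\,\cdot)\overset d=a^hY_1(\cdot)$ for every $a>0$; and $Y_1$ is quasi-left-continuous with respect to its augmented natural filtration. Functional limit condition with parameters $(\mu,h,\ell,Y_1,Y_2)$, for a pair $(Z_1,Z_2)$. $Z_1,Z_2$ are processes with sample paths in $\mathbb D$ and $\mathbb D_+$, $Z_1(0)=0$ a.s.; $\mu,h\in\mathbb R$; $\ell$ is an eventually positive function slowly varying at infinity; $Y_1\in\mathbb D$, $Y_2\in\mathbb D_+$ are processes such that, as $\varepsilon\to0^+$, $$\Big(\varepsilon^h\ell(\varepsilon^{-1})\big(Z_1(\tfrac{\cdot}{\varepsilon})-\tfrac{\cdot}{\varepsilon}\mu\big),\ \varepsilon^h\ell(\varepsilon^{-1})\sqrt{Z_2(\tfrac{\cdot}{\varepsilon})}\Big)\Rightarrow\big(Y_1(\cdot),\sqrt{Y_2(\cdot)}\big)\quad\text{weakly in }\mathrm{WM}_2.$$ Moreover: (a) $0<h<1$; (b) as $t\to\infty$, $(Z_1(t)-\mu t)/t\to0$ and $Z_2(t)/t^2\to0$ a.s.; (c) for every $a>0$, $(Y_1(a\,\cdot),Y_2(a\,\cdot))\overset d=(a^hY_1(\cdot),a^{2h}Y_2(\cdot))$; (d) $Y_1$ is quasi-left-continuous with respect to the augmented natural filtration of $(Y_1,Y_2)$; (e) almost surely $Y_2(t)>0$ for every $t>0$, and $Y_2$ has no negative jumps. *)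

theory Defs
  imports "HOL-Probability.Probability"
begin

section \<open>Paths and the M2 topology\<close>

text \<open>Time is \<^typ>\<open>real\<close>; only the values at times \<open>t \<ge> 0\<close> are ever relevant.\<close>

definition cadlag :: "(real \<Rightarrow> real) \<Rightarrow> bool" where
  "cadlag x \<longleftrightarrow> (\<forall>t\<ge>0. (x \<longlongrightarrow> x t) (at_right t)) \<and> (\<forall>t>0. \<exists>l. (x \<longlongrightarrow> l) (at_left t))"

definition D_space :: "(real \<Rightarrow> real) set" where
  "D_space = {x \<in> extensional {0..}. cadlag x}"

text \<open>Left limit, with the convention \<open>x(0-) = x(0)\<close>.\<close>

definition left_lim :: "(real \<Rightarrow> real) \<Rightarrow> real \<Rightarrow> real" where
  "left_lim x t = (if t > 0 then Lim (at_left t) x else x t)"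

definition jump :: "(real \<Rightarrow> real) \<Rightarrow> real \<Rightarrow> real" where
  "jump x t = x t - left_lim x t"

definition completed_graph :: "real \<Rightarrow> (real \<Rightarrow> real) \<Rightarrow> (real \<times> real) set" where
  "completed_graph T x = {(t, z). 0 \<le> t \<and> t \<le> T \<and> z \<in> closed_segment (left_lim x t) (x t)}"

definition hausdorff_distance :: "'a::metric_space set \<Rightarrow> 'a set \<Rightarrow> real" where
  "hausdorff_distance A B = max (SUP a\<in>A. infdist a B) (SUP b\<in>B. infdist b A)"

text \<open>M2 convergence on \<open>[0,\<infinity>)\<close>: convergence of the restrictions to \<open>[0,T]\<close>
  at every continuity point \<open>T\<close> of the limit.\<close>

definition M2_convergent_to :: "(nat \<Rightarrow> real \<Rightarrow> real) \<Rightarrow> (real \<Rightarrow> real) \<Rightarrow> bool" where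
  "M2_convergent_to xs x \<longleftrightarrow>
     (\<forall>T>0. isCont x T \<longrightarrow>
       (\<lambda>n. hausdorff_distance (completed_graph T (xs n)) (completed_graph T x)) \<longlonglongrightarrow> 0)"

text \<open>The M2 topology on \<open>D([0,\<infinity>))\<close> is specified only through its convergent sequences, so it is
  taken to be the topology of sequentially open sets. As this convergence is metrizable, it is
  the metrizable topology with these convergent sequences.\<close>

definition M2_open :: "(real \<Rightarrow> real) set \<Rightarrow> bool" where
  "M2_open U \<longleftrightarrow> U \<subseteq> D_space \<and>
     (\<forall>x\<in>U. \<forall>xs. range xs \<subseteq> D_space \<and> M2_convergent_to xs x \<longrightarrow> (\<forall>\<^sub>F n in sequentially. xs n \<in> U))"

definition M2_topology :: "(real \<Rightarrow> real) topology" where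
  "M2_topology = topology M2_open"

lemma istopology_M2_open: "istopology M2_open"
  unfolding istopology_def
proof (intro conjI allI impI)
  fix S T assume "M2_open S" "M2_open T"
  then show "M2_open (S \<inter> T)"
    unfolding M2_open_def by (auto intro: eventually_conj)
next
  fix K assume K: "\<forall>U\<in>K. M2_open U"
  show "M2_open (\<Union>K)"
    unfolding M2_open_def
  proof (intro conjI ballI allI impI)
    show "\<Union>K \<subseteq> D_space" using K by (auto simp: M2_open_def)
    fix x xs assume "x \<in> \<Union>K" and xs: "range xs \<subseteq> D_space \<and> M2_convergent_to xs x"
    then obtain U where U: "U \<in> K" "x \<in> U" by blast
    then have "\<forall>\<^sub>F n in sequentially. xs n \<in> U"
      using K xs by (auto simp: M2_open_def)
    then show "\<forall>\<^sub>F n in sequentially. xs n \<in> \<Union>K"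
      by eventually_elim (use U in blast)
  qed
qed

lemma openin_M2_topology [simp]: "openin M2_topology = M2_open"
  by (simp add: M2_topology_def istopology_M2_open topology_inverse')

lemma topspace_M2_topology [simp]: "topspace M2_topology = D_space"
  unfolding topspace_def openin_M2_topology
  by (auto simp: M2_open_def image_subset_iff intro!: exI[of _ D_space])

definition WM2_topology :: "((real \<Rightarrow> real) \<times> (real \<Rightarrow> real)) topology" where
  "WM2_topology = prod_topology M2_topology M2_topology"

section \<open>Processes, laws and weak convergence\<close>

text \<open>Processes are understood modulo null sets: path properties hold almost surely, and
  measurability and expectations refer to the completed probability. Path properties cannot hold
  surely in general: if \<open>Z(0) = 0\<close> fails on a nonempty null event, the time-averaged process below
  is not right-continuous at \<open>0\<close> there.\<close>

definition D_process :: "'a measure \<Rightarrow> (real \<Rightarrow> 'a \<Rightarrow> real) \<Rightarrow> bool" where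
  "D_process M X \<longleftrightarrow>
     (\<forall>t\<ge>0. X t \<in> borel_measurable (completion M)) \<and> (AE \<omega> in M. cadlag (\<lambda>t. X t \<omega>))"

definition D_plus_process :: "'a measure \<Rightarrow> (real \<Rightarrow> 'a \<Rightarrow> real) \<Rightarrow> bool" where
  "D_plus_process M X \<longleftrightarrow> D_process M X \<and> (AE \<omega> in M. \<forall>t\<ge>0. 0 \<le> X t \<omega>)"

definition sample_path :: "(real \<Rightarrow> 'a \<Rightarrow> 'c) \<Rightarrow> 'a \<Rightarrow> real \<Rightarrow> 'c" where
  "sample_path X \<omega> = (\<lambda>t\<in>{0..}. X t \<omega>)"

text \<open>The law on path space with the \<open>\<sigma>\<close>-algebra generated by the coordinate projections.\<close>

definition process_law :: "'a measure \<Rightarrow> (real \<Rightarrow> 'a \<Rightarrow> 'c::topological_space) \<Rightarrow> (real \<Rightarrow> 'c) measure" where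
  "process_law M X = distr (completion M) (PiM {0..} (\<lambda>_. borel)) (sample_path X)"

definition weakly_converges ::
    "'c topology \<Rightarrow> 'a measure \<Rightarrow> ('i \<Rightarrow> 'a \<Rightarrow> 'c) \<Rightarrow> 'b measure \<Rightarrow> ('b \<Rightarrow> 'c) \<Rightarrow> 'i filter \<Rightarrow> bool" where
  "weakly_converges \<T> M X N Y F \<longleftrightarrow>
     (\<forall>f :: 'c \<Rightarrow> real. continuous_map \<T> euclideanreal f \<and> bounded (f ` topspace \<T>) \<longrightarrow>
        ((\<lambda>i. \<integral>\<omega>. f (X i \<omega>) \<partial>completion M) \<longlongrightarrow> (\<integral>\<omega>. f (Y \<omega>) \<partial>completion N)) F)"

section \<open>Filtrations and quasi-left-continuity\<close>

text \<open>The usual augmentation: null sets are adjoined and the filtration is made right-continuous.\<close>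

definition augmented_natural_filtration ::
    "'a measure \<Rightarrow> (real \<Rightarrow> 'a \<Rightarrow> 'c::topological_space) \<Rightarrow> real \<Rightarrow> 'a measure" where
  "augmented_natural_filtration M X t = sigma (space M)
     (\<Inter>u\<in>{t<..}. sigma_sets (space M)
        ({X s -` B \<inter> space M | s B. 0 \<le> s \<and> s \<le> u \<and> B \<in> sets borel} \<union> null_sets (completion M)))"

text \<open>Finite predictable stopping times, i.e. those announced by a sequence of stopping times.\<close>

definition finite_predictable_time ::
    "'a measure \<Rightarrow> (real \<Rightarrow> 'a measure) \<Rightarrow> ('a \<Rightarrow> real) \<Rightarrow> bool" where
  "finite_predictable_time M F \<tau> \<longleftrightarrow>
     stopping_time F \<tau> \<and> (\<forall>\<omega>\<in>space M. 0 \<le> \<tau> \<omega>) \<and>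
     (\<exists>\<sigma> :: nat \<Rightarrow> 'a \<Rightarrow> real.
        (\<forall>n. stopping_time F (\<sigma> n)) \<and>
        (\<forall>\<omega>\<in>space M. (\<forall>n. 0 \<le> \<sigma> n \<omega>) \<and> incseq (\<lambda>n. \<sigma> n \<omega>) \<and>
           (\<lambda>n. \<sigma> n \<omega>) \<longlonglongrightarrow> \<tau> \<omega> \<and> (\<tau> \<omega> > 0 \<longrightarrow> (\<forall>n. \<sigma> n \<omega> < \<tau> \<omega>))))"

definition quasi_left_continuous ::
    "'a measure \<Rightarrow> (real \<Rightarrow> 'a measure) \<Rightarrow> (real \<Rightarrow> 'a \<Rightarrow> real) \<Rightarrow> bool" where
  "quasi_left_continuous M F Y \<longleftrightarrow>
     (\<forall>\<tau>. finite_predictable_time M F \<tau> \<longrightarrow> (AE \<omega> in M. jump (\<lambda>t. Y t \<omega>) (\<tau> \<omega>) = 0))"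

section \<open>The two limit conditions\<close>

definition slowly_varying :: "(real \<Rightarrow> real) \<Rightarrow> bool" where
  "slowly_varying l \<longleftrightarrow> (\<forall>a>0. ((\<lambda>x. l (a * x) / l x) \<longlongrightarrow> 1) at_top)"

definition scaled_centred ::
    "real \<Rightarrow> real \<Rightarrow> (real \<Rightarrow> real) \<Rightarrow> (real \<Rightarrow> 'a \<Rightarrow> real) \<Rightarrow> real \<Rightarrow> real \<Rightarrow> 'a \<Rightarrow> real" where
  "scaled_centred \<mu> h l Z \<epsilon> t \<omega> = \<epsilon> powr h * l (1 / \<epsilon>) * (Z (t / \<epsilon>) \<omega> - t / \<epsilon> * \<mu>)"

definition scaled_sqrt ::
    "real \<Rightarrow> (real \<Rightarrow> real) \<Rightarrow> (real \<Rightarrow> 'a \<Rightarrow> real) \<Rightarrow> real \<Rightarrow> real \<Rightarrow> 'a \<Rightarrow> real" where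
  "scaled_sqrt h l Z \<epsilon> t \<omega> = \<epsilon> powr h * l (1 / \<epsilon>) * sqrt (Z (t / \<epsilon>) \<omega>)"

definition marginal_limit_condition ::
    "'a measure \<Rightarrow> (real \<Rightarrow> 'a \<Rightarrow> real) \<Rightarrow> real \<Rightarrow> real \<Rightarrow> (real \<Rightarrow> real) \<Rightarrow>
     'b measure \<Rightarrow> (real \<Rightarrow> 'b \<Rightarrow> real) \<Rightarrow> bool" where
  "marginal_limit_condition M Z1 \<mu> h l N Y1 \<longleftrightarrow>
     D_process M Z1 \<and> (AE \<omega> in M. Z1 0 \<omega> = 0) \<and>
     0 < h \<and> h < 1 \<and>
     (\<forall>\<^sub>F x in at_top. l x > 0) \<and> slowly_varying l \<and>
     D_process N Y1 \<and>
     weakly_converges M2_topology M (\<lambda>\<epsilon>. sample_path (scaled_centred \<mu> h l Z1 \<epsilon>))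
       N (sample_path Y1) (at_right 0) \<and>
     (AE \<omega> in M. ((\<lambda>t. (Z1 t \<omega> - \<mu> * t) / t) \<longlongrightarrow> 0) at_top) \<and>
     (\<forall>a>0. process_law N (\<lambda>t. Y1 (a * t)) = process_law N (\<lambda>t \<omega>. a powr h * Y1 t \<omega>)) \<and>
     quasi_left_continuous N (augmented_natural_filtration N Y1) Y1"

definition WM2_functional_limit ::
    "'a measure \<Rightarrow> (real \<Rightarrow> 'a \<Rightarrow> real) \<Rightarrow> (real \<Rightarrow> 'a \<Rightarrow> real) \<Rightarrow> real \<Rightarrow> real \<Rightarrow> (real \<Rightarrow> real) \<Rightarrow>
     'b measure \<Rightarrow> (real \<Rightarrow> 'b \<Rightarrow> real) \<Rightarrow> (real \<Rightarrow> 'b \<Rightarrow> real) \<Rightarrow> bool" where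
  "WM2_functional_limit M Z1 Z2 \<mu> h l N Y1 Y2 \<longleftrightarrow>
     weakly_converges WM2_topology
       M (\<lambda>\<epsilon> \<omega>. (sample_path (scaled_centred \<mu> h l Z1 \<epsilon>) \<omega>, sample_path (scaled_sqrt h l Z2 \<epsilon>) \<omega>))
       N (\<lambda>\<omega>. (sample_path Y1 \<omega>, sample_path (\<lambda>t \<omega>. sqrt (Y2 t \<omega>)) \<omega>))
       (at_right 0)"

definition functional_limit_condition ::
    "'a measure \<Rightarrow> (real \<Rightarrow> 'a \<Rightarrow> real) \<Rightarrow> (real \<Rightarrow> 'a \<Rightarrow> real) \<Rightarrow> real \<Rightarrow> real \<Rightarrow> (real \<Rightarrow> real) \<Rightarrow>
     'b measure \<Rightarrow> (real \<Rightarrow> 'b \<Rightarrow> real) \<Rightarrow> (real \<Rightarrow> 'b \<Rightarrow> real) \<Rightarrow> bool" where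
  "functional_limit_condition M Z1 Z2 \<mu> h l N Y1 Y2 \<longleftrightarrow>
     D_process M Z1 \<and> D_plus_process M Z2 \<and> (AE \<omega> in M. Z1 0 \<omega> = 0) \<and>
     (\<forall>\<^sub>F x in at_top. l x > 0) \<and> slowly_varying l \<and>
     D_process N Y1 \<and> D_plus_process N Y2 \<and>
     WM2_functional_limit M Z1 Z2 \<mu> h l N Y1 Y2 \<and>
     0 < h \<and> h < 1 \<and>
     (AE \<omega> in M. ((\<lambda>t. (Z1 t \<omega> - \<mu> * t) / t) \<longlongrightarrow> 0) at_top) \<and>
     (AE \<omega> in M. ((\<lambda>t. Z2 t \<omega> / t\<^sup>2) \<longlongrightarrow> 0) at_top) \<and>
     (\<forall>a>0. process_law N (\<lambda>t \<omega>. (Y1 (a * t) \<omega>, Y2 (a * t) \<omega>)) =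
            process_law N (\<lambda>t \<omega>. (a powr h * Y1 t \<omega>, a powr (2 * h) * Y2 t \<omega>))) \<and>
     quasi_left_continuous N (augmented_natural_filtration N (\<lambda>t \<omega>. (Y1 t \<omega>, Y2 t \<omega>))) Y1 \<and>
     (AE \<omega> in N. \<forall>t>0. Y2 t \<omega> > 0) \<and>
     (AE \<omega> in N. \<forall>t\<ge>0. jump (\<lambda>t. Y2 t \<omega>) t \<ge> 0)"

section \<open>Batch means\<close>

definition batch_increment :: "nat \<Rightarrow> nat \<Rightarrow> (real \<Rightarrow> 'a \<Rightarrow> real) \<Rightarrow> real \<Rightarrow> 'a \<Rightarrow> real" where
  "batch_increment m k X t \<omega> = X (real k / real m * t) \<omega> - X ((real k - 1) / real m * t) \<omega>"

text \<open>Applied to \<open>Z\<^sub>1\<close> and \<open>Y\<^sub>1\<close> this gives the second components of the batch-means pairs;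
  the first components are \<open>Z\<^sub>1\<close> and \<open>Y\<^sub>1\<close> themselves.\<close>

definition batch_means_average :: "nat \<Rightarrow> (real \<Rightarrow> 'a \<Rightarrow> real) \<Rightarrow> real \<Rightarrow> 'a \<Rightarrow> real" where
  "batch_means_average m X t \<omega> =
     (if t > 0 then
        1 / (real m - 1) *
          (\<Sum>k=1..m. 1 / t * (LINT s:{0..t}|lborel. (batch_increment m k X s \<omega> - 1 / real m * X s \<omega>)\<^sup>2))
      else 0)"

end

theory Submission
  imports Defs
begin

text \<open>
  Why the theorem is true. Both second components are the same functional of the first ones. Put
  \<open>\<Phi> x t = sqrt (V x t)\<close>, where \<open>V\<close> is the time-averaged variance of the \<open>m\<close> batch increments
  (\<open>batch_variance\<close> below). A linear drift adds the same amount to every batch increment and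
  disappears on centring, and \<open>V\<close> is quadratic in the path, so \<open>\<Phi>\<close> of the rescaled centred path of
  \<open>Z\<^sub>1\<close> is the rescaled second component. The limit theorem is thus the continuous mapping theorem
  for \<open>x \<mapsto> (x, \<Phi> x)\<close>.

  The substitution \<open>s = t * u\<close> turns the time average \<open>1/t \<integral>\<^sub>0\<^sup>t\<close> into an integral over the fixed
  interval \<open>[0,1]\<close>. In this form \<open>V\<close> makes sense at \<open>t = 0\<close>, and dominated convergence gives the
  central estimate \<open>batch_variance_tendsto\<close>: if \<open>xs n\<close> converges to \<open>x\<close> in \<open>M\<^sub>2\<close> and \<open>ts n\<close> to \<open>t\<close>, then
  \<open>V (xs n) (ts n)\<close> converges to \<open>V x t\<close>. The reason is that \<open>M\<^sub>2\<close> convergence forces convergence at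
  the continuity points of \<open>x\<close>, which are all but countably many times, and local boundedness. Since
  \<open>ts n\<close> may vary, this one statement contains the continuity of \<open>V x\<close> and the locally uniform
  convergence of \<open>V (xs n)\<close>; between continuous paths the latter implies \<open>M\<^sub>2\<close> convergence. Hence
  \<open>\<Phi>\<close> is continuous at every cadlag path, including at those with jumps and at those not starting at
  \<open>0\<close>.

  The same estimate, used for other sequences of paths, gives most of the functional limit condition.
  Applied to the discretisations \<open>x (\<lfloor>n s\<rfloor> / n)\<close> it presents \<open>V x t\<close> as a limit of measurable
  functions of finitely many values of \<open>x\<close> at times up to \<open>t\<close>. So the second component is adapted to the
  augmented filtration of the first, which leaves that filtration and quasi-left-continuity unchanged,
  and the joint law is determined by the law of the first component, which carries over
  self-similarity. Applied to \<open>(Z\<^sub>1 (T s) - \<mu> T s) / T\<close>, which tends to the zero path as \<open>T \<rightarrow> \<infinity>\<close>, it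
  gives the growth condition.

  Self-similarity also shows that \<open>Y\<^sub>1 0 = 0\<close> almost surely, so that \<open>V\<close> and the time average, set
  to zero at time zero, agree. It moves positivity from time \<open>1\<close> to every fixed time, and
  since \<open>t * Y\<^sub>2 t\<close> is nondecreasing, positivity holds at all times simultaneously.
\<close>

section \<open>Cadlag paths\<close>

lemma cadlag_cong:
  assumes "\<And>t. t \<ge> 0 \<Longrightarrow> x t = y t"
  shows "cadlag x \<longleftrightarrow> cadlag y"
proof -
  have r: "(x \<longlongrightarrow> x t) (at_right t) \<longleftrightarrow> (y \<longlongrightarrow> y t) (at_right t)" if "t \<ge> 0" for t
  proof -
    have "\<forall>\<^sub>F s in at_right t. x s = y s"
      using that by (auto simp: eventually_at_right_field intro!: exI[of _ "t + 1"] assms)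
    then show ?thesis using assms[OF that] by (simp add: tendsto_cong)
  qed
  have "(x \<longlongrightarrow> c) (at_left t) \<longleftrightarrow> (y \<longlongrightarrow> c) (at_left t)" if "t > 0" for t c
  proof -
    have "\<forall>\<^sub>F s in at_left t. x s = y s"
      using that by (auto simp: eventually_at_left_field intro!: exI[of _ 0] assms)
    then show ?thesis by (simp add: tendsto_cong)
  qed
  with r show ?thesis by (simp add: cadlag_def)
qed

lemma cadlag_restrict: "cadlag (restrict x {0..}) \<longleftrightarrow> cadlag x"
  by (rule cadlag_cong) auto

lemma cadlag_tendsto_left_lim:
  assumes "cadlag x" "t > 0"
  shows "(x \<longlongrightarrow> left_lim x t) (at_left t)"
proof -
  obtain c where "(x \<longlongrightarrow> c) (at_left t)"
    using assms by (auto simp: cadlag_def)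
  then show ?thesis
    using assms(2) by (simp add: left_lim_def tendsto_Lim)
qed

lemma left_lim_in_closed:
  assumes "cadlag x" "t > 0" "closed C" "\<forall>\<^sub>F s in at_left t. x s \<in> C"
  shows "left_lim x t \<in> C"
  by (rule Lim_in_closed_set[OF assms(3,4) _ cadlag_tendsto_left_lim[OF assms(1,2)]]) simp

lemma at_within_nonneg:
  fixes t :: real
  shows "t > 0 \<Longrightarrow> at t within {0..} = at t" "at 0 within {0..} = at_right (0::real)"
  by (auto intro!: at_within_interior simp: at_within_Ici_at_right)

lemma continuous_imp_cadlag:
  assumes "continuous_on {0..} x"
  shows "cadlag x"
proof -
  have c: "(x \<longlongrightarrow> x t) (at t within {0..})" if "t \<ge> 0" for t
    using assms that by (auto simp: continuous_on_def)
  have "(x \<longlongrightarrow> x t) (at_right t)" if "t \<ge> 0" for t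
    by (rule tendsto_mono[OF _ c[OF that]]) (use that in \<open>auto intro!: at_le\<close>)
  moreover have "(x \<longlongrightarrow> x t) (at_left t)" if "t > 0" for t
    using c[of t] that by (simp add: at_within_nonneg filterlim_at_split)
  ultimately show ?thesis by (auto simp: cadlag_def)
qed

lemma left_lim_continuous:
  assumes "continuous_on {0..} x" "t \<ge> 0"
  shows "left_lim x t = x t"
proof (cases "t > 0")
  case True
  have "(x \<longlongrightarrow> x t) (at t within {0..})"
    using assms by (auto simp: continuous_on_def)
  then have "(x \<longlongrightarrow> x t) (at_left t)"
    using True by (simp add: at_within_nonneg filterlim_at_split)
  then show ?thesis using True by (simp add: left_lim_def tendsto_Lim)
qed (use assms in \<open>simp add: left_lim_def\<close>)

text \<open>One-sided limits give a bound near every point, and compactness of \<open>[0,T]\<close>, in the form of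
  bisection, makes it uniform.\<close>

lemma cadlag_bounded:
  assumes "cadlag x"
  obtains B where "\<And>s. 0 \<le> s \<Longrightarrow> s \<le> T \<Longrightarrow> \<bar>x s\<bar> \<le> B"
proof -
  have "bounded (x ` ({0..T} \<inter> {0..}))" if T: "0 \<le> T"
    using T
  proof (induction rule: Bolzano[where P = "\<lambda>a b. bounded (x ` ({a..b} \<inter> {0..}))"])
    case (trans a b c)
    have "{a..c} \<inter> {0..} \<subseteq> ({a..b} \<inter> {0..}) \<union> ({b..c} \<inter> {0..})" by auto
    then have "x ` ({a..c} \<inter> {0..}) \<subseteq> x ` ({a..b} \<inter> {0..}) \<union> x ` ({b..c} \<inter> {0..})"
      by blast
    moreover have "bounded (x ` ({a..b} \<inter> {0..}) \<union> x ` ({b..c} \<inter> {0..}))"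
      using trans(1,2) by simp
    ultimately show ?case by (rule bounded_subset[rotated])
  next
    case (local t)
    have "\<forall>\<^sub>F s in at_right t. \<bar>x s\<bar> \<le> \<bar>x t\<bar> + 1"
    proof -
      have "\<forall>\<^sub>F s in at_right t. dist (x s) (x t) < 1"
        using assms local by (auto simp: cadlag_def intro: tendstoD)
      then show ?thesis by eventually_elim (auto simp: dist_real_def)
    qed
    then obtain b where b: "b > t" "\<And>s. t < s \<Longrightarrow> s < b \<Longrightarrow> \<bar>x s\<bar> \<le> \<bar>x t\<bar> + 1"
      by (auto simp: eventually_at_right_field)
    obtain a B where a: "a < t" "\<And>s. 0 \<le> s \<Longrightarrow> a < s \<Longrightarrow> s < t \<Longrightarrow> \<bar>x s\<bar> \<le> B"
    proof (cases "t > 0")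
      case True
      have "\<forall>\<^sub>F s in at_left t. dist (x s) (left_lim x t) < 1"
        using cadlag_tendsto_left_lim[OF assms True] by (auto intro: tendstoD)
      then have "\<forall>\<^sub>F s in at_left t. \<bar>x s\<bar> \<le> \<bar>left_lim x t\<bar> + 1"
        by eventually_elim (auto simp: dist_real_def)
      then show ?thesis using that by (auto simp: eventually_at_left_field)
    next
      case False
      then show ?thesis using that[of "t - 1" 0] local by auto
    qed
    show ?case
    proof (intro exI[of _ "min (t - a) (b - t)"] conjI allI impI)
      fix u v assume uv: "u \<le> t \<and> t \<le> v \<and> v - u < min (t - a) (b - t)"
      have "\<bar>x s\<bar> \<le> max (\<bar>x t\<bar> + 1) B" if "s \<in> {u..v} \<inter> {0..}" for s
      proof (cases "s < t")
        case True
        then show ?thesis using a(2)[of s] that uv by auto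
      next
        case False
        then show ?thesis using b(2)[of s] that uv by (cases "s = t") auto
      qed
      then show "bounded (x ` ({u..v} \<inter> {0..}))"
        unfolding bounded_iff real_norm_def by blast
    qed (use a b in auto)
  qed
  then obtain B where "\<And>s. 0 \<le> s \<Longrightarrow> s \<le> T \<Longrightarrow> \<bar>x s\<bar> \<le> B"
    unfolding bounded_iff real_norm_def by force
  then show ?thesis by (rule that)
qed

definition discontinuities :: "(real \<Rightarrow> real) \<Rightarrow> real set" where
  "discontinuities x = {s. 0 \<le> s \<and> \<not> continuous (at s within {0..}) x}"

lemma zero_notin_discontinuities: "cadlag x \<Longrightarrow> 0 \<notin> discontinuities x"
  by (auto simp: discontinuities_def cadlag_def continuous_within at_within_nonneg)

text \<open>Jumps of size above \<open>e\<close> cannot accumulate: on a small interval to one side of any point the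
  path stays within \<open>e/2\<close> of its one-sided limit. Each such set of jump times is therefore
  countable, and every discontinuity is a jump.\<close>

lemma cadlag_countable_discontinuities:
  assumes "cadlag x"
  shows "countable (discontinuities x)"
proof -
  define A where "A e = {t. 0 < t \<and> \<bar>left_lim x t - x t\<bar> > e}" for e
  have countable_A: "countable (A e)" if e: "e > 0" for e
  proof -
    have near: "s \<notin> A e"
      if s: "a < s" "s < b" and ab: "\<And>r. a < r \<Longrightarrow> r < b \<Longrightarrow> \<bar>x r - c\<bar> < e / 2" for a b c s
    proof
      assume "s \<in> A e"
      then have s0: "0 < s" "\<bar>left_lim x s - x s\<bar> > e" by (auto simp: A_def)
      have "\<forall>\<^sub>F r in at_left s. x r \<in> cball c (e / 2)"
        using s ab
        by (force simp: eventually_at_left_field dist_real_def abs_minus_commute intro!: exI[of _ a] less_imp_le)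
      then have "left_lim x s \<in> cball c (e / 2)"
        by (rule left_lim_in_closed[OF assms s0(1) closed_cball])
      moreover have "\<bar>x s - c\<bar> < e / 2" using ab s by auto
      ultimately show False using s0(2) unfolding mem_cball dist_real_def by linarith
    qed
    have "A e sparse_in UNIV"
      unfolding sparse_in_eventually_iff[OF open_UNIV]
    proof
      fix t :: real
      show "\<forall>\<^sub>F s in at t. s \<notin> A e"
        unfolding eventually_at_split
      proof
        show "\<forall>\<^sub>F s in at_left t. s \<notin> A e"
        proof (cases "t > 0")
          case True
          have "\<forall>\<^sub>F s in at_left t. dist (x s) (left_lim x t) < e / 2"
            by (rule tendstoD[OF cadlag_tendsto_left_lim[OF assms True]]) (use e in simp)
          then obtain a where "a < t" "\<And>s. a < s \<Longrightarrow> s < t \<Longrightarrow> \<bar>x s - left_lim x t\<bar> < e / 2"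
            by (auto simp: eventually_at_left_field dist_real_def)
          then show ?thesis using near[of a _ t] by (auto simp: eventually_at_left_field)
        next
          case False
          then show ?thesis
            by (auto simp: eventually_at_left_field A_def intro!: exI[of _ "t - 1"])
        qed
        show "\<forall>\<^sub>F s in at_right t. s \<notin> A e"
        proof (cases "t \<ge> 0")
          case True
          have "\<forall>\<^sub>F s in at_right t. dist (x s) (x t) < e / 2"
            by (rule tendstoD) (use assms True e in \<open>auto simp: cadlag_def\<close>)
          then obtain b where "t < b" "\<And>s. t < s \<Longrightarrow> s < b \<Longrightarrow> \<bar>x s - x t\<bar> < e / 2"
            by (auto simp: eventually_at_right_field dist_real_def)
          then show ?thesis using near[of t _ b] by (auto simp: eventually_at_right_field)
        next
          case False
          then show ?thesis
            by (auto simp: eventually_at_right_field A_def intro!: exI[of _ 0])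
        qed
      qed
    qed
    from sparse_imp_countable[OF open_UNIV this] show ?thesis by simp
  qed
  have "discontinuities x \<subseteq> (\<Union>n. A (1 / real (Suc n)))"
  proof
    fix t assume t: "t \<in> discontinuities x"
    then have t0: "t > 0"
      using zero_notin_discontinuities[OF assms]
      by (cases "t = 0") (auto simp: discontinuities_def)
    have "left_lim x t \<noteq> x t"
    proof
      assume "left_lim x t = x t"
      then have "(x \<longlongrightarrow> x t) (at t)"
        using cadlag_tendsto_left_lim[OF assms t0] assms t0
        by (auto simp: filterlim_at_split cadlag_def)
      with t t0 show False
        by (auto simp: discontinuities_def continuous_within at_within_nonneg)
    qed
    then have "\<bar>left_lim x t - x t\<bar> > 0" by simp
    then obtain n where "1 / real (Suc n) < \<bar>left_lim x t - x t\<bar>"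
      using nat_approx_posE by metis
    then show "t \<in> (\<Union>n. A (1 / real (Suc n)))" using t0 by (auto simp: A_def)
  qed
  then show ?thesis
    by (rule countable_subset) (intro countable_UN countable_A; simp)
qed

lemma cadlag_borel_measurable:
  assumes "cadlag x"
  shows "(\<lambda>s. x (max 0 s)) \<in> borel_measurable borel"
proof (rule borel_measurable_continuous_countable_exceptions)
  show "countable (discontinuities x)" by (rule cadlag_countable_discontinuities[OF assms])
  show "continuous_on (- discontinuities x) (\<lambda>s. x (max 0 s))"
  proof (intro continuous_at_imp_continuous_on ballI)
    fix s assume s: "s \<in> - discontinuities x"
    have "continuous (at (max 0 s) within {0..}) x"
      using s zero_notin_discontinuities[OF assms]
      by (cases "s \<ge> 0") (auto simp: discontinuities_def max_def)
    then have "continuous (at (max 0 s) within range (max 0)) x"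
      by (rule continuous_within_subset) auto
    moreover have "isCont (max 0) s"
      by (intro continuous_intros)
    ultimately show "isCont (\<lambda>s. x (max 0 s)) s"
      using continuous_within_compose[of s UNIV "max 0" x] by (simp add: o_def)
  qed
qed

text \<open>A path has only countably many discontinuities, so arbitrarily late times are admissible in
  the definition of \<open>M\<^sub>2\<close> convergence.\<close>

lemma cadlag_continuity_point_above:
  assumes "cadlag x" "a \<ge> 0"
  obtains T where "T > a" "isCont x T"
proof -
  have "uncountable {a<..<a + 1}" by (simp add: uncountable_open_interval)
  then have "\<not> {a<..<a + 1} \<subseteq> discontinuities x"
    using cadlag_countable_discontinuities[OF assms(1)] countable_subset by blast
  then obtain T where "a < T" "T \<notin> discontinuities x"
    by (metis greaterThanLessThan_iff subsetI)
  with assms(2) show ?thesis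
    using that[of T] by (auto simp: discontinuities_def at_within_nonneg)
qed

section \<open>Convergence at continuity points\<close>

text \<open>All that the integrals below see of \<open>M\<^sub>2\<close> convergence: local uniform convergence at each
  continuity point of the limit, and local boundedness. Unlike \<open>M\<^sub>2\<close> convergence, it is immediate
  for the discretised paths used later to prove measurability.\<close>

definition converges_at_continuity_points :: "(nat \<Rightarrow> real \<Rightarrow> real) \<Rightarrow> (real \<Rightarrow> real) \<Rightarrow> bool" where
  "converges_at_continuity_points xs x \<longleftrightarrow>
     (\<forall>T. \<exists>B. \<forall>\<^sub>F n in sequentially. \<forall>s. 0 \<le> s \<and> s \<le> T \<longrightarrow> \<bar>xs n s\<bar> \<le> B) \<and>
     (\<forall>s\<ge>0. s \<notin> discontinuities x \<longrightarrow> (\<forall>e>0. \<exists>d>0. \<forall>\<^sub>F n in sequentially.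
        \<forall>r. 0 \<le> r \<and> \<bar>r - s\<bar> < d \<longrightarrow> \<bar>xs n r - x s\<bar> < e))"

lemma continuous_nearby:
  assumes "0 \<le> s" "s \<notin> discontinuities x" "e > 0"
  obtains d where "d > 0" "\<And>r. 0 \<le> r \<Longrightarrow> \<bar>r - s\<bar> < d \<Longrightarrow> \<bar>x r - x s\<bar> < e"
  using assms by (auto simp: discontinuities_def continuous_within_eps_delta dist_real_def)

lemma converges_at_continuity_points_subseq:
  assumes "converges_at_continuity_points xs x" "strict_mono r"
  shows "converges_at_continuity_points (\<lambda>n. xs (r n)) x"
proof -
  have *: "\<forall>\<^sub>F n in sequentially. P (xs (r n))" if "\<forall>\<^sub>F n in sequentially. P (xs n)" for P
    using eventually_subseq[OF assms(2) that] .
  show ?thesis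
    unfolding converges_at_continuity_points_def
  proof (intro conjI allI impI)
    fix T
    obtain B where "\<forall>\<^sub>F n in sequentially. \<forall>s. 0 \<le> s \<and> s \<le> T \<longrightarrow> \<bar>xs n s\<bar> \<le> B"
      using assms(1) unfolding converges_at_continuity_points_def by blast
    from *[OF this] show "\<exists>B. \<forall>\<^sub>F n in sequentially. \<forall>s. 0 \<le> s \<and> s \<le> T \<longrightarrow> \<bar>xs (r n) s\<bar> \<le> B"
      by (rule exI)
  next
    fix s e :: real assume "0 \<le> s" "s \<notin> discontinuities x" "0 < e"
    then obtain d where d: "d > 0"
      "\<forall>\<^sub>F n in sequentially. \<forall>u. 0 \<le> u \<and> \<bar>u - s\<bar> < d \<longrightarrow> \<bar>xs n u - x s\<bar> < e"
      using assms(1) unfolding converges_at_continuity_points_def by blast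
    from d(1) *[OF d(2)]
    show "\<exists>d>0. \<forall>\<^sub>F n in sequentially. \<forall>u. 0 \<le> u \<and> \<bar>u - s\<bar> < d \<longrightarrow> \<bar>xs (r n) u - x s\<bar> < e"
      by (intro exI[of _ d] conjI)
  qed
qed

lemma converges_at_continuity_pointsD:
  assumes "converges_at_continuity_points xs x" "0 \<le> s" "s \<notin> discontinuities x"
    "\<And>n. 0 \<le> r n" "r \<longlonglongrightarrow> s"
  shows "(\<lambda>n. xs n (r n)) \<longlonglongrightarrow> x s"
proof (rule tendstoI)
  fix e :: real assume "e > 0"
  then obtain d where d: "d > 0"
    "\<forall>\<^sub>F n in sequentially. \<forall>u. 0 \<le> u \<and> \<bar>u - s\<bar> < d \<longrightarrow> \<bar>xs n u - x s\<bar> < e"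
    using assms(1-3) unfolding converges_at_continuity_points_def by blast
  from d(2) tendstoD[OF assms(5) d(1)] show "\<forall>\<^sub>F n in sequentially. dist (xs n (r n)) (x s) < e"
    by eventually_elim (use assms(4) in \<open>auto simp: dist_real_def\<close>)
qed

lemma converges_at_continuity_points_const:
  assumes "cadlag x"
  shows "converges_at_continuity_points (\<lambda>_. x) x"
  unfolding converges_at_continuity_points_def
proof (intro conjI allI impI)
  fix T
  obtain B where "\<And>s. 0 \<le> s \<Longrightarrow> s \<le> T \<Longrightarrow> \<bar>x s\<bar> \<le> B"
    using cadlag_bounded[OF assms] by blast
  then show "\<exists>B. \<forall>\<^sub>F n in sequentially. \<forall>s. 0 \<le> s \<and> s \<le> T \<longrightarrow> \<bar>x s\<bar> \<le> B" by auto
next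
  fix s e :: real assume "s \<ge> 0" "s \<notin> discontinuities x" "e > 0"
  then obtain d where "d > 0" "\<And>r. 0 \<le> r \<Longrightarrow> \<bar>r - s\<bar> < d \<Longrightarrow> \<bar>x r - x s\<bar> < e"
    using continuous_nearby by blast
  then show "\<exists>d>0. \<forall>\<^sub>F n in sequentially. \<forall>r. 0 \<le> r \<and> \<bar>r - s\<bar> < d \<longrightarrow> \<bar>x r - x s\<bar> < e"
    by (intro exI[of _ d]) simp
qed

section \<open>Consequences of M2 convergence\<close>

text \<open>A vertical segment of the completed graph joins two limits of nearby values of the path, so a
  closed convex set containing these values contains the segment.\<close>

lemma completed_graph_in_closed_convex:
  assumes "cadlag x" "(t, z) \<in> completed_graph T x" "closed C" "convex C" "d > 0"
    "\<And>r. 0 \<le> r \<Longrightarrow> \<bar>r - t\<bar> < d \<Longrightarrow> x r \<in> C"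
  shows "z \<in> C"
proof -
  have t: "0 \<le> t" and z: "z \<in> closed_segment (left_lim x t) (x t)"
    using assms(2) by (auto simp: completed_graph_def)
  have "left_lim x t \<in> C"
  proof (cases "t > 0")
    case True
    have "\<forall>\<^sub>F r in at_left t. x r \<in> C"
      using True assms(5,6) by (auto simp: eventually_at_left_field intro!: exI[of _ "max 0 (t - d)"])
    then show ?thesis by (rule left_lim_in_closed[OF assms(1) True assms(3)])
  next
    case False
    then show ?thesis using t assms(5,6) by (simp add: left_lim_def)
  qed
  moreover have "x t \<in> C" using t assms(5,6) by simp
  ultimately show ?thesis
    using z assms(4) by (auto simp: convex_contains_segment)
qed

lemma graph_subset_completed_graph: "0 \<le> s \<Longrightarrow> s \<le> T \<Longrightarrow> (s, x s) \<in> completed_graph T x"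
  by (simp add: completed_graph_def)

lemma bounded_completed_graph:
  assumes "cadlag x"
  shows "bounded (completed_graph T x)"
proof -
  obtain B where B: "\<And>s. 0 \<le> s \<Longrightarrow> s \<le> T + 1 \<Longrightarrow> \<bar>x s\<bar> \<le> B"
    using cadlag_bounded[OF assms] by blast
  have "completed_graph T x \<subseteq> {0..T} \<times> cball 0 B"
  proof safe
    fix t z assume tz: "(t, z) \<in> completed_graph T x"
    then show "t \<in> {0..T}" by (auto simp: completed_graph_def)
    show "z \<in> cball 0 B"
      by (rule completed_graph_in_closed_convex[OF assms tz, of _ 1])
        (use B \<open>t \<in> {0..T}\<close> in \<open>auto simp: dist_real_def\<close>)
  qed
  then show ?thesis
    by (rule bounded_subset[rotated]) (auto intro: bounded_Times)
qed

lemma infdist_less_hausdorff_distance: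
  assumes "bounded A" "bounded B" "B \<noteq> {}" "a \<in> A" "hausdorff_distance A B < e"
  obtains b where "b \<in> B" "dist a b < e"
proof -
  obtain b0 where b0: "b0 \<in> B" using assms(3) by blast
  obtain K where K: "\<And>a. a \<in> A \<Longrightarrow> dist b0 a \<le> K"
    using assms(1) bounded_any_center by metis
  have "bdd_above ((\<lambda>a. infdist a B) ` A)"
  proof (rule bdd_aboveI2)
    fix a assume "a \<in> A"
    then show "infdist a B \<le> K"
      using infdist_le[OF b0, of a] K[of a] by (simp add: dist_commute)
  qed
  then have "infdist a B \<le> (SUP a\<in>A. infdist a B)"
    using assms(4) by (rule cSUP_upper[rotated])
  with assms(5) have "infdist a B < e"
    by (simp add: hausdorff_distance_def)
  then have "\<exists>b\<in>B. dist a b < e"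
    using assms(3) by (simp add: infdist_def cINF_less_iff)
  then show ?thesis using that by blast
qed

lemma M2_convergent_graph_close:
  assumes "range xs \<subseteq> D_space" "x \<in> D_space" "M2_convergent_to xs x" "T > 0" "isCont x T" "e > 0"
  shows "\<forall>\<^sub>F n in sequentially. \<forall>s. 0 \<le> s \<and> s \<le> T \<longrightarrow>
    (\<exists>t z. (t, z) \<in> completed_graph T x \<and> \<bar>s - t\<bar> < e \<and> \<bar>xs n s - z\<bar> < e)"
proof -
  have "(\<lambda>n. hausdorff_distance (completed_graph T (xs n)) (completed_graph T x)) \<longlonglongrightarrow> 0"
    using assms(3-5) by (auto simp: M2_convergent_to_def)
  then have "\<forall>\<^sub>F n in sequentially.
      hausdorff_distance (completed_graph T (xs n)) (completed_graph T x) < e"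
    using assms(6) by (rule order_tendstoD)
  then show ?thesis
  proof eventually_elim
    case (elim n)
    show ?case
    proof (intro allI impI)
      fix s assume "0 \<le> s \<and> s \<le> T"
      then have s: "(s, xs n s) \<in> completed_graph T (xs n)"
        by (simp add: graph_subset_completed_graph)
      have "(0, x 0) \<in> completed_graph T x"
        using assms(4) by (simp add: graph_subset_completed_graph)
      then have ne: "completed_graph T x \<noteq> {}" by blast
      have "cadlag x" "cadlag (xs n)" using assms(1,2) by (auto simp: D_space_def)
      then obtain b where b: "b \<in> completed_graph T x" "dist (s, xs n s) b < e"
        using infdist_less_hausdorff_distance[OF _ _ ne s elim] bounded_completed_graph by metis
      have "dist s (fst b) < e" "dist (xs n s) (snd b) < e"
        using b(2) dist_fst_le[of "(s, xs n s)" b] dist_snd_le[of "(s, xs n s)" b] by auto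
      with b(1) show "\<exists>t z. (t, z) \<in> completed_graph T x \<and> \<bar>s - t\<bar> < e \<and> \<bar>xs n s - z\<bar> < e"
        by (intro exI[of _ "fst b"] exI[of _ "snd b"]) (simp add: dist_real_def)
    qed
  qed
qed

text \<open>Each point of the graph of \<open>xs n\<close> is close to a point of the completed graph of \<open>x\<close>, and over a
  short interval around a continuity point the completed graph of \<open>x\<close> is nearly flat. This
  includes the time \<open>0\<close>, where \<open>x\<close> is right-continuous.\<close>

lemma M2_convergent_imp_converges_at_continuity_points:
  assumes "range xs \<subseteq> D_space" "x \<in> D_space" "M2_convergent_to xs x"
  shows "converges_at_continuity_points xs x"
  unfolding converges_at_continuity_points_def
proof (intro conjI allI impI)
  have cx: "cadlag x" using assms(2) by (simp add: D_space_def)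
  fix T :: real
  obtain T' where T': "T' > max T 0" "isCont x T'"
    using cadlag_continuity_point_above[OF cx, of "max T 0"] by auto
  obtain B where B: "\<And>z. z \<in> completed_graph T' x \<Longrightarrow> norm z \<le> B"
    using bounded_completed_graph[OF cx, of T'] by (auto simp: bounded_iff)
  have "\<forall>\<^sub>F n in sequentially. \<forall>s. 0 \<le> s \<and> s \<le> T' \<longrightarrow>
    (\<exists>t z. (t, z) \<in> completed_graph T' x \<and> \<bar>s - t\<bar> < 1 \<and> \<bar>xs n s - z\<bar> < 1)"
    by (rule M2_convergent_graph_close[OF assms]) (use T' in auto)
  then have "\<forall>\<^sub>F n in sequentially. \<forall>s. 0 \<le> s \<and> s \<le> T \<longrightarrow> \<bar>xs n s\<bar> \<le> B + 1"
  proof eventually_elim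
    case (elim n)
    show ?case
    proof (intro allI impI)
      fix s assume "0 \<le> s \<and> s \<le> T"
      then obtain t z where tz: "(t, z) \<in> completed_graph T' x" "\<bar>xs n s - z\<bar> < 1"
        using elim T'(1) by fastforce
      have "\<bar>z\<bar> \<le> norm (t, z)" using norm_snd_le[of z t] by simp
      then show "\<bar>xs n s\<bar> \<le> B + 1" using B[OF tz(1)] tz(2) by linarith
    qed
  qed
  then show "\<exists>B. \<forall>\<^sub>F n in sequentially. \<forall>s. 0 \<le> s \<and> s \<le> T \<longrightarrow> \<bar>xs n s\<bar> \<le> B" by blast
next
  have cx: "cadlag x" using assms(2) by (simp add: D_space_def)
  fix s e :: real assume s: "0 \<le> s" "s \<notin> discontinuities x" and e: "0 < e"
  obtain d where d: "d > 0" "\<And>r. 0 \<le> r \<Longrightarrow> \<bar>r - s\<bar> < d \<Longrightarrow> \<bar>x r - x s\<bar> < e / 2"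
    using continuous_nearby[OF s, of "e / 2"] e by auto
  obtain T where T: "T > s + 1" "isCont x T"
    using cadlag_continuity_point_above[OF cx, of "s + 1"] s by auto
  \<comment> \<open>A quarter of \<open>d\<close> for the distance from \<open>s\<close> to \<open>r\<close> and another for that from \<open>r\<close> to \<open>t\<close> leave
    a window of radius \<open>d / 2\<close> around \<open>t\<close>.\<close>
  define \<eta> where "\<eta> = min (d / 4) (e / 2)"
  have "\<eta> > 0" using d e by (simp add: \<eta>_def)
  have "\<forall>\<^sub>F n in sequentially. \<forall>r. 0 \<le> r \<and> r \<le> T \<longrightarrow>
    (\<exists>t z. (t, z) \<in> completed_graph T x \<and> \<bar>r - t\<bar> < \<eta> \<and> \<bar>xs n r - z\<bar> < \<eta>)"
    by (rule M2_convergent_graph_close[OF assms]) (use T s \<open>\<eta> > 0\<close> in auto)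
  then have "\<forall>\<^sub>F n in sequentially. \<forall>r. 0 \<le> r \<and> \<bar>r - s\<bar> < min 1 (d / 4) \<longrightarrow> \<bar>xs n r - x s\<bar> < e"
  proof eventually_elim
    case (elim n)
    show ?case
    proof (intro allI impI)
      fix r assume r: "0 \<le> r \<and> \<bar>r - s\<bar> < min 1 (d / 4)"
      then have "r \<le> T" using T by auto
      then obtain t z where tz: "(t, z) \<in> completed_graph T x" "\<bar>r - t\<bar> < \<eta>" "\<bar>xs n r - z\<bar> < \<eta>"
        using elim r by blast
      have "\<bar>r - s\<bar> < d / 4" "\<bar>r - t\<bar> < d / 4" using r tz(2) by (auto simp: \<eta>_def)
      then have "\<bar>t - s\<bar> < d / 2" by linarith
      then have "x u \<in> cball (x s) (e / 2)" if "0 \<le> u" "\<bar>u - t\<bar> < d / 2" for u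
        using d(2)[of u] that unfolding mem_cball dist_real_def by linarith
      then have "z \<in> cball (x s) (e / 2)"
        by (rule completed_graph_in_closed_convex[OF cx tz(1) closed_cball convex_cball half_gt_zero[OF d(1)]])
      moreover have "\<bar>xs n r - z\<bar> < e / 2" using tz(3) by (simp add: \<eta>_def)
      ultimately show "\<bar>xs n r - x s\<bar> < e" unfolding mem_cball dist_real_def by linarith
    qed
  qed
  then show "\<exists>d>0. \<forall>\<^sub>F n in sequentially. \<forall>r. 0 \<le> r \<and> \<bar>r - s\<bar> < d \<longrightarrow> \<bar>xs n r - x s\<bar> < e"
    using d(1) by (intro exI[of _ "min 1 (d / 4)"]) simp
qed

lemma SUP_infdist_graphs:
  fixes v w :: "real \<Rightarrow> real"
  assumes "T \<ge> 0" and close: "\<And>t. t \<in> {0..T} \<Longrightarrow> \<bar>v t - w t\<bar> \<le> e"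
  shows "(SUP a\<in>(\<lambda>t. (t, v t)) ` {0..T}. infdist a ((\<lambda>t. (t, w t)) ` {0..T})) \<in> {0..e}"
proof -
  let ?V = "(\<lambda>t. (t, v t)) ` {0..T}" and ?W = "(\<lambda>t. (t, w t)) ` {0..T}"
  have le: "infdist a ?W \<le> e" if "a \<in> ?V" for a
  proof -
    obtain t where t: "t \<in> {0..T}" "a = (t, v t)" using \<open>a \<in> ?V\<close> by (elim imageE)
    have "dist a (t, w t) \<le> e"
      using close[OF t(1)] t(2) by (simp add: dist_Pair_Pair dist_real_def)
    moreover have "(t, w t) \<in> ?W" using t by blast
    ultimately show ?thesis by (meson infdist_le2)
  qed
  have ne: "(0, v 0) \<in> ?V" using assms(1) by auto
  have "(SUP a\<in>?V. infdist a ?W) \<le> e"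
    using ne le by (intro cSUP_least) auto
  moreover have "bdd_above ((\<lambda>a. infdist a ?W) ` ?V)"
    using le by (rule bdd_aboveI2)
  then have "infdist (0, v 0) ?W \<le> (SUP a\<in>?V. infdist a ?W)"
    by (rule cSUP_upper[OF ne])
  then have "0 \<le> (SUP a\<in>?V. infdist a ?W)"
    using infdist_nonneg order_trans by blast
  ultimately show ?thesis by simp
qed

text \<open>For continuous paths the completed graphs are the graphs, and vertical distances bound the
  Hausdorff distance.\<close>

lemma uniform_imp_M2_convergent:
  assumes "\<And>n. continuous_on {0..} (ys n)" "continuous_on {0..} y"
    and "\<And>T e. T > 0 \<Longrightarrow> e > 0 \<Longrightarrow> \<forall>\<^sub>F n in sequentially. \<forall>t\<in>{0..T}. \<bar>ys n t - y t\<bar> < e"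
  shows "M2_convergent_to ys y"
  unfolding M2_convergent_to_def
proof (intro allI impI)
  fix T :: real assume T: "T > 0"
  have graph: "completed_graph T x = (\<lambda>t. (t, x t)) ` {0..T}" if "continuous_on {0..} x" for x
    using left_lim_continuous[OF that] by (auto simp: completed_graph_def)
  show "(\<lambda>n. hausdorff_distance (completed_graph T (ys n)) (completed_graph T y)) \<longlonglongrightarrow> 0"
  proof (rule tendstoI)
    fix e :: real assume e: "e > 0"
    have "\<forall>\<^sub>F n in sequentially. \<forall>t\<in>{0..T}. \<bar>ys n t - y t\<bar> < e / 2"
      by (rule assms(3)) (use T e in auto)
    then show "\<forall>\<^sub>F n in sequentially.
        dist (hausdorff_distance (completed_graph T (ys n)) (completed_graph T y)) 0 < e"
    proof eventually_elim
      case (elim n)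
      have "\<bar>ys n t - y t\<bar> \<le> e / 2" "\<bar>y t - ys n t\<bar> \<le> e / 2" if "t \<in> {0..T}" for t
        using elim that by (fastforce simp: abs_minus_commute intro: less_imp_le)+
      then have "(SUP a\<in>(\<lambda>t. (t, ys n t)) ` {0..T}. infdist a ((\<lambda>t. (t, y t)) ` {0..T})) \<in> {0..e / 2}"
        "(SUP a\<in>(\<lambda>t. (t, y t)) ` {0..T}. infdist a ((\<lambda>t. (t, ys n t)) ` {0..T})) \<in> {0..e / 2}"
        using T by (auto intro!: SUP_infdist_graphs simp del: atLeastAtMost_iff)
      with e show ?case
        unfolding atLeastAtMost_iff hausdorff_distance_def graph[OF assms(1)] graph[OF assms(2)] dist_real_def
        by linarith
    qed
  qed
qed

section \<open>The batch-means variance of a path\<close>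

definition batch_deviation :: "nat \<Rightarrow> nat \<Rightarrow> (real \<Rightarrow> real) \<Rightarrow> real \<Rightarrow> real" where
  "batch_deviation m k x s =
     x (real k / real m * s) - x ((real k - 1) / real m * s) - 1 / real m * x s"

text \<open>This is the time-averaged sample variance after the substitution \<open>s = t * u\<close>. It agrees with
  \<^const>\<open>batch_means_average\<close> for \<open>t > 0\<close>; at \<open>t = 0\<close> it takes a multiple of \<open>(x 0)\<^sup>2\<close> as its value,
  which makes it continuous at \<open>0\<close> for every cadlag path and not only for those starting at \<open>0\<close>.\<close>

definition batch_variance :: "nat \<Rightarrow> (real \<Rightarrow> real) \<Rightarrow> real \<Rightarrow> real" where
  "batch_variance m x t =
     1 / (real m - 1) * (\<Sum>k=1..m. LINT u:{0..1}|lborel. (batch_deviation m k x (t * u))\<^sup>2)"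

lemma set_integral_rescale:
  fixes f :: "real \<Rightarrow> real"
  assumes "t > 0"
  shows "(LINT s:{0..t}|lborel. f s) = t * (LINT u:{0..1}|lborel. f (t * u))"
proof -
  have "indicator {0..t} (t * u) = (indicator {0..1} u :: real)" for u
    using assms by (auto simp: indicator_def zero_le_mult_iff mult_le_cancel_left1)
  then show ?thesis
    unfolding set_lebesgue_integral_def
    by (subst lborel_integral_real_affine[where c = t and t = 0]) (use assms in auto)
qed

lemma batch_means_average_eq_batch_variance:
  assumes "t \<ge> 0" "X 0 \<omega> = 0"
  shows "batch_means_average m X t \<omega> = batch_variance m (\<lambda>s. X s \<omega>) t"
proof (cases "t > 0")
  case True
  then show ?thesis
    by (simp add: batch_means_average_def batch_variance_def batch_increment_def
        batch_deviation_def set_integral_rescale[OF True])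
next
  case False
  then show ?thesis
    using assms by (simp add: batch_means_average_def batch_variance_def batch_deviation_def)
qed

text \<open>A linear drift contributes \<open>b * s / m\<close> to every batch increment and is removed by centring at
  the mean.\<close>

lemma batch_variance_affine:
  assumes y: "\<And>s. s \<ge> 0 \<Longrightarrow> y s = c * (x (a * s) + b * s)" and "t \<ge> 0" "m \<ge> 1"
  shows "batch_variance m y t = c\<^sup>2 * batch_variance m x (a * t)"
proof -
  have dev: "batch_deviation m k y s = c * batch_deviation m k x (a * s)" if "s \<ge> 0" "k \<ge> 1" for s k
  proof -
    have "b * (real k / real m * s) - b * ((real k - 1) / real m * s) - 1 / real m * (b * s) = 0"
      using assms(3) by (simp add: field_simps)
    moreover have "y (real k / real m * s) = c * (x (a * (real k / real m * s)) + b * (real k / real m * s))"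
      "y ((real k - 1) / real m * s) = c * (x (a * ((real k - 1) / real m * s)) + b * ((real k - 1) / real m * s))"
      using that by (intro y mult_nonneg_nonneg divide_nonneg_nonneg; simp)+
    ultimately show ?thesis
      using y[OF that(1)] unfolding batch_deviation_def
      by (simp add: algebra_simps)
  qed
  have "(LINT u:{0..1}|lborel. (batch_deviation m k y (t * u))\<^sup>2)
      = c\<^sup>2 * (LINT u:{0..1}|lborel. (batch_deviation m k x (a * t * u))\<^sup>2)" if "k \<in> {1..m}" for k
  proof -
    have "(LINT u:{0..1}|lborel. (batch_deviation m k y (t * u))\<^sup>2)
        = (LINT u:{0..1}|lborel. c\<^sup>2 * (batch_deviation m k x (a * t * u))\<^sup>2)"
      using that assms(2)
      by (intro set_lebesgue_integral_cong) (auto simp: dev power_mult_distrib mult.assoc)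
    then show ?thesis by simp
  qed
  then show ?thesis
    unfolding batch_variance_def by (simp add: sum_distrib_left algebra_simps)
qed

lemma batch_variance_nonneg: "m \<ge> 1 \<Longrightarrow> batch_variance m x t \<ge> 0"
  unfolding batch_variance_def set_lebesgue_integral_def
  by (intro mult_nonneg_nonneg sum_nonneg Bochner_Integration.integral_nonneg) auto

lemma batch_deviation_measurable:
  assumes "(\<lambda>s. x (max 0 s)) \<in> borel_measurable borel" "t \<ge> 0" "k \<ge> 1"
  shows "(\<lambda>u. indicator {0..a} u *\<^sub>R (batch_deviation m k x (t * u))\<^sup>2) \<in> borel_measurable lborel"
proof -
  define y where "y s = x (max 0 s)" for s
  have [measurable]: "y \<in> borel_measurable borel"
    using assms(1) by (simp add: y_def[abs_def])
  have "(\<lambda>u. indicator {0..a} u *\<^sub>R (batch_deviation m k x (t * u))\<^sup>2)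
      = (\<lambda>u. indicator {0..a} u *\<^sub>R (batch_deviation m k y (t * u))\<^sup>2)"
    using assms(2,3) by (auto simp: batch_deviation_def y_def fun_eq_iff indicator_def max_def)
  moreover have "(\<lambda>u. indicator {0..a} u *\<^sub>R (batch_deviation m k y (t * u))\<^sup>2) \<in> borel_measurable lborel"
    unfolding batch_deviation_def by measurable
  ultimately show ?thesis by simp
qed

lemma batch_deviation_bound:
  assumes "\<And>s. 0 \<le> s \<Longrightarrow> s \<le> T \<Longrightarrow> \<bar>x s\<bar> \<le> B" "0 \<le> s" "s \<le> T" "1 \<le> k" "k \<le> m"
  shows "(batch_deviation m k x s)\<^sup>2 \<le> (3 * B)\<^sup>2"
proof -
  have m: "m \<ge> 1" using assms(4,5) by simp
  have "real k / real m * s \<le> 1 * s" "(real k - 1) / real m * s \<le> 1 * s"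
    using assms by (intro mult_right_mono; simp)+
  then have "\<bar>x (real k / real m * s)\<bar> \<le> B" "\<bar>x ((real k - 1) / real m * s)\<bar> \<le> B" "\<bar>x s\<bar> \<le> B"
    using assms by (auto intro!: assms(1))
  moreover have "\<bar>1 / real m * x s\<bar> \<le> \<bar>x s\<bar>"
    using m mult_right_mono[of "1 / real m" 1 "\<bar>x s\<bar>"] by (simp add: abs_mult)
  ultimately have "\<bar>batch_deviation m k x s\<bar> \<le> 3 * B"
    unfolding batch_deviation_def by linarith
  then have "\<bar>batch_deviation m k x s\<bar> \<le> \<bar>3 * B\<bar>" by linarith
  then show ?thesis by (simp only: abs_le_square_iff)
qed

text \<open>Dominated convergence: for all but countably many \<open>u\<close> the three times at which the integrand
  samples the path are continuity points of \<open>x\<close>. This includes \<open>t = 0\<close>, since \<open>0\<close> is always a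
  continuity point. The times \<open>ts n\<close> vary with \<open>n\<close> so that local uniformity comes for free.\<close>

lemma batch_variance_tendsto:
  assumes conv: "converges_at_continuity_points xs x" and x: "cadlag x"
    and meas: "\<And>n. (\<lambda>s. xs n (max 0 s)) \<in> borel_measurable borel"
    and ts: "ts \<longlonglongrightarrow> t" "\<And>n. 0 \<le> ts n"
  shows "(\<lambda>n. batch_variance m (xs n) (ts n)) \<longlonglongrightarrow> batch_variance m x t"
proof -
  have t: "t \<ge> 0" using LIMSEQ_le_const[OF ts(1)] ts(2) by blast
  obtain T where T: "\<And>n. ts n \<le> T"
    using convergent_imp_Bseq[of ts] ts(1)
    by (auto simp: convergent_def Bseq_def abs_le_iff)
  obtain B where "\<forall>\<^sub>F n in sequentially. \<forall>s. 0 \<le> s \<and> s \<le> T \<longrightarrow> \<bar>xs n s\<bar> \<le> B"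
    using conv unfolding converges_at_continuity_points_def by blast
  then obtain N where N: "\<And>n s. N \<le> n \<Longrightarrow> 0 \<le> s \<Longrightarrow> s \<le> T \<Longrightarrow> \<bar>xs n s\<bar> \<le> B"
    by (auto simp: eventually_sequentially)
  have "(\<lambda>n. \<integral>u. indicator {0..1} u *\<^sub>R (batch_deviation m k (xs n) (ts n * u))\<^sup>2 \<partial>lborel)
      \<longlonglongrightarrow> (\<integral>u. indicator {0..1} u *\<^sub>R (batch_deviation m k x (t * u))\<^sup>2 \<partial>lborel)"
    if k: "k \<in> {1..m}" for k
  proof (rule LIMSEQ_offset[of _ N], rule integral_dominated_convergence)
    show "(\<lambda>u. indicator {0..1} u *\<^sub>R (batch_deviation m k x (t * u))\<^sup>2) \<in> borel_measurable lborel"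
      by (rule batch_deviation_measurable) (use k t x in \<open>auto intro: cadlag_borel_measurable\<close>)
    show "(\<lambda>u. indicator {0..1} u *\<^sub>R (batch_deviation m k (xs (n + N)) (ts (n + N) * u))\<^sup>2)
        \<in> borel_measurable lborel" for n
      by (rule batch_deviation_measurable) (use k ts meas in auto)
    show "integrable lborel (\<lambda>u. indicator {0..1::real} u * (3 * B)\<^sup>2)"
      by simp
    show "AE u in lborel. norm (indicator {0..1} u *\<^sub>R
        (batch_deviation m k (xs (n + N)) (ts (n + N) * u))\<^sup>2) \<le> indicator {0..1} u * (3 * B)\<^sup>2" for n
    proof (rule AE_I2)
      fix u :: real
      show "norm (indicator {0..1} u *\<^sub>R (batch_deviation m k (xs (n + N)) (ts (n + N) * u))\<^sup>2)
        \<le> indicator {0..1} u * (3 * B)\<^sup>2"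
      proof (cases "u \<in> {0..1}")
        case True
        then have "ts (n + N) * u \<le> ts (n + N) * 1" using ts(2) by (intro mult_left_mono) auto
        then have "ts (n + N) * u \<le> T" using T[of "n + N"] by simp
        then have "(batch_deviation m k (xs (n + N)) (ts (n + N) * u))\<^sup>2 \<le> (3 * B)\<^sup>2"
          using True ts(2) k N by (intro batch_deviation_bound) auto
        then show ?thesis using True by simp
      qed simp
    qed
    define E where "E c = {u. c * (t * u) \<in> discontinuities x}" for c
    have "countable (E c)" for c
    proof (cases "c * t = 0")
      case True
      then show ?thesis
        using zero_notin_discontinuities[OF x] by (auto simp: E_def mult.assoc[symmetric])
    next
      case False
      have "E c \<subseteq> (\<lambda>s. s / (c * t)) ` discontinuities x"
      proof
        fix u assume "u \<in> E c"
        then show "u \<in> (\<lambda>s. s / (c * t)) ` discontinuities x"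
          using False by (intro image_eqI[of _ _ "c * (t * u)"]) (auto simp: E_def)
      qed
      then show ?thesis
        using cadlag_countable_discontinuities[OF x] by (meson countable_image countable_subset)
    qed
    then have "AE u in lborel. u \<notin> E c" for c
      by (intro AE_not_in countable_imp_null_set_lborel)
    from this[of "real k / real m"] this[of "(real k - 1) / real m"] this[of 1]
    show "AE u in lborel. (\<lambda>n. indicator {0..1} u *\<^sub>R
        (batch_deviation m k (xs (n + N)) (ts (n + N) * u))\<^sup>2)
        \<longlonglongrightarrow> indicator {0..1} u *\<^sub>R (batch_deviation m k x (t * u))\<^sup>2"
    proof eventually_elim
      case (elim u)
      have lim: "(\<lambda>n. xs n (c * (ts n * u))) \<longlonglongrightarrow> x (c * (t * u))"
        if "0 \<le> c" "u \<notin> E c" "u \<in> {0..1}" for c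
      proof (rule converges_at_continuity_pointsD[OF conv])
        show "(\<lambda>n. c * (ts n * u)) \<longlonglongrightarrow> c * (t * u)"
          by (intro tendsto_mult tendsto_const ts(1))
      qed (use that t ts(2) in \<open>auto simp: E_def\<close>)
      show ?case
      proof (cases "u \<in> {0..1}")
        case True
        have "(\<lambda>n. (batch_deviation m k (xs n) (ts n * u))\<^sup>2) \<longlonglongrightarrow> (batch_deviation m k x (t * u))\<^sup>2"
          unfolding batch_deviation_def
          using lim[OF _ elim(1) True] lim[OF _ elim(2) True] lim[OF _ elim(3) True] k
          by (intro tendsto_intros) auto
        from LIMSEQ_ignore_initial_segment[OF this, of N] True show ?thesis by simp
      qed simp
    qed
  qed
  then show ?thesis
    unfolding batch_variance_def set_lebesgue_integral_def
    by (intro tendsto_mult tendsto_const tendsto_sum)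
qed

lemma batch_variance_continuous:
  assumes "cadlag x"
  shows "continuous_on {0..} (batch_variance m x)"
  unfolding continuous_on_sequentially
proof (intro allI ballI impI)
  fix ts :: "nat \<Rightarrow> real" and t assume ts: "(\<forall>n. ts n \<in> {0..}) \<and> ts \<longlonglongrightarrow> t"
  show "(batch_variance m x \<circ> ts) \<longlonglongrightarrow> batch_variance m x t"
    unfolding o_def
    by (rule batch_variance_tendsto[OF converges_at_continuity_points_const[OF assms] assms
          cadlag_borel_measurable[OF assms]]) (use ts in auto)
qed

text \<open>Continuous convergence is uniform on compact intervals: otherwise times \<open>ts n\<close> of bad
  approximation accumulate at some \<open>t\<close>. The hypothesis speaks of subsequences since the bad indices
  form one.\<close>

lemma continuous_convergence_imp_uniform:
  fixes f :: "nat \<Rightarrow> real \<Rightarrow> real"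
  assumes sub: "\<And>r ts t. strict_mono r \<Longrightarrow> (\<And>n. 0 \<le> ts n) \<Longrightarrow> ts \<longlonglongrightarrow> t \<Longrightarrow>
      (\<lambda>n. f (r n) (ts n)) \<longlonglongrightarrow> g t"
    and cont: "continuous_on {0..} g" and "e > 0"
  shows "\<forall>\<^sub>F n in sequentially. \<forall>t\<in>{0..T}. \<bar>f n t - g t\<bar> < e"
proof (rule ccontr)
  assume "\<not> ?thesis"
  then have "\<exists>\<^sub>F n in cofinite. \<exists>t\<in>{0..T}. \<not> \<bar>f n t - g t\<bar> < e"
    by (simp add: not_eventually cofinite_eq_sequentially)
  then have "infinite {n. \<exists>t\<in>{0..T}. \<not> \<bar>f n t - g t\<bar> < e}"
    by (simp add: frequently_cofinite)
  from infinite_enumerate[OF this] obtain r :: "nat \<Rightarrow> nat" where r: "strict_mono r"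
    "\<And>n. \<exists>t\<in>{0..T}. \<not> \<bar>f (r n) t - g t\<bar> < e"
    unfolding mem_Collect_eq by blast
  from r(2) obtain ts where ts: "\<And>n. ts n \<in> {0..T}" "\<And>n. \<not> \<bar>f (r n) (ts n) - g (ts n)\<bar> < e"
    by metis
  obtain t q where q: "t \<in> {0..T}" "strict_mono q" "(ts \<circ> q) \<longlonglongrightarrow> t"
    using compact_Icc[of 0 T] ts(1) unfolding compact_def by metis
  have "(\<lambda>n. f (r (q n)) (ts (q n))) \<longlonglongrightarrow> g t"
    using sub[OF strict_mono_o[OF r(1) q(2)] _ q(3)] ts(1) by (simp add: o_def)
  moreover have "(\<lambda>n. g (ts (q n))) \<longlonglongrightarrow> g t"
    using continuous_on_tendsto_compose[OF cont q(3)] q(1) ts(1) by (auto simp: o_def)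
  ultimately have "(\<lambda>n. f (r (q n)) (ts (q n)) - g (ts (q n))) \<longlonglongrightarrow> 0"
    using tendsto_diff by force
  then have "\<forall>\<^sub>F n in sequentially. \<bar>f (r (q n)) (ts (q n)) - g (ts (q n))\<bar> < e"
    using \<open>e > 0\<close> by (auto dest!: tendstoD[where e = e] simp: dist_real_def)
  then show False using ts(2) by (auto simp: eventually_sequentially)
qed

definition sqrt_batch_variance_path :: "nat \<Rightarrow> (real \<Rightarrow> real) \<Rightarrow> real \<Rightarrow> real" where
  "sqrt_batch_variance_path m x = (\<lambda>t\<in>{0..}. sqrt (batch_variance m x t))"

lemma continuous_on_sqrt_batch_variance_path:
  assumes "cadlag x"
  shows "continuous_on {0..} (sqrt_batch_variance_path m x)"
proof -
  have "continuous_on {0..} (\<lambda>t. sqrt (batch_variance m x t))"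
    using batch_variance_continuous[OF assms] by (intro continuous_intros)
  then show ?thesis
    by (rule continuous_on_eq) (simp add: sqrt_batch_variance_path_def)
qed

lemma M2_convergent_sqrt_batch_variance_path:
  assumes "range xs \<subseteq> D_space" "x \<in> D_space" "M2_convergent_to xs x"
  shows "M2_convergent_to (\<lambda>n. sqrt_batch_variance_path m (xs n)) (sqrt_batch_variance_path m x)"
proof -
  have c: "cadlag x" "\<And>n. cadlag (xs n)" using assms(1,2) by (auto simp: D_space_def)
  note conv = M2_convergent_imp_converges_at_continuity_points[OF assms]
  show ?thesis
  proof (rule uniform_imp_M2_convergent)
    fix T e :: real assume "e > 0"
    show "\<forall>\<^sub>F n in sequentially. \<forall>t\<in>{0..T}.
      \<bar>sqrt_batch_variance_path m (xs n) t - sqrt_batch_variance_path m x t\<bar> < e"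
    proof (rule continuous_convergence_imp_uniform[OF _ _ \<open>e > 0\<close>])
      fix r :: "nat \<Rightarrow> nat" and ts :: "nat \<Rightarrow> real" and t
      assume r: "strict_mono r" and ts: "\<And>n. 0 \<le> ts n" "ts \<longlonglongrightarrow> t"
      have "t \<ge> 0" using LIMSEQ_le_const[OF ts(2)] ts(1) by blast
      moreover have "(\<lambda>n. sqrt (batch_variance m (xs (r n)) (ts n))) \<longlonglongrightarrow> sqrt (batch_variance m x t)"
        by (intro tendsto_real_sqrt batch_variance_tendsto converges_at_continuity_points_subseq[OF conv r]
            c ts cadlag_borel_measurable)
      ultimately show "(\<lambda>n. sqrt_batch_variance_path m (xs (r n)) (ts n)) \<longlonglongrightarrow> sqrt_batch_variance_path m x t"
        using ts(1) by (simp add: sqrt_batch_variance_path_def)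
    qed (intro continuous_on_sqrt_batch_variance_path c)
  qed (intro continuous_on_sqrt_batch_variance_path c)+
qed

lemma sqrt_batch_variance_path_in_D_space:
  "cadlag x \<Longrightarrow> sqrt_batch_variance_path m x \<in> D_space"
  using continuous_imp_cadlag[OF continuous_on_sqrt_batch_variance_path]
  by (simp add: D_space_def sqrt_batch_variance_path_def)

lemma continuous_map_sqrt_batch_variance_path:
  "continuous_map M2_topology M2_topology (sqrt_batch_variance_path m)"
  unfolding continuous_map
proof (intro conjI allI impI)
  show "sqrt_batch_variance_path m ` topspace M2_topology \<subseteq> topspace M2_topology"
    using sqrt_batch_variance_path_in_D_space by (auto simp: D_space_def)
  fix U assume "openin M2_topology U"
  then have U: "U \<subseteq> D_space"
    "\<And>x xs. x \<in> U \<Longrightarrow> range xs \<subseteq> D_space \<Longrightarrow> M2_convergent_to xs x \<Longrightarrow> \<forall>\<^sub>F n in sequentially. xs n \<in> U"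
    by (auto simp: M2_open_def)
  show "openin M2_topology {x \<in> topspace M2_topology. sqrt_batch_variance_path m x \<in> U}"
    unfolding openin_M2_topology M2_open_def
  proof (intro conjI ballI allI impI)
    fix x xs
    assume x: "x \<in> {x \<in> topspace M2_topology. sqrt_batch_variance_path m x \<in> U}"
      and xs: "range xs \<subseteq> D_space \<and> M2_convergent_to xs x"
    have "\<forall>\<^sub>F n in sequentially. sqrt_batch_variance_path m (xs n) \<in> U"
    proof (rule U(2))
      show "sqrt_batch_variance_path m x \<in> U" using x by simp
      show "range (\<lambda>n. sqrt_batch_variance_path m (xs n)) \<subseteq> D_space"
      proof clarify
        fix n
        have "cadlag (xs n)" using xs by (auto simp: D_space_def)
        then show "sqrt_batch_variance_path m (xs n) \<in> D_space"
          by (rule sqrt_batch_variance_path_in_D_space)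
      qed
      show "M2_convergent_to (\<lambda>n. sqrt_batch_variance_path m (xs n)) (sqrt_batch_variance_path m x)"
        using x xs by (intro M2_convergent_sqrt_batch_variance_path) auto
    qed
    then show "\<forall>\<^sub>F n in sequentially. xs n \<in> {x \<in> topspace M2_topology. sqrt_batch_variance_path m x \<in> U}"
      by eventually_elim (use xs in auto)
  qed auto
qed

section \<open>Measurability\<close>

definition sampled_path :: "nat \<Rightarrow> (real \<Rightarrow> real) \<Rightarrow> real \<Rightarrow> real" where
  "sampled_path n x s = x (real_of_int \<lfloor>real (Suc n) * s\<rfloor> / real (Suc n))"

lemma sampling_time:
  assumes "s \<ge> 0"
  shows "0 \<le> real_of_int \<lfloor>real (Suc n) * s\<rfloor> / real (Suc n)"
    "real_of_int \<lfloor>real (Suc n) * s\<rfloor> / real (Suc n) \<le> s"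
    "s < real_of_int \<lfloor>real (Suc n) * s\<rfloor> / real (Suc n) + 1 / real (Suc n)"
proof -
  let ?a = "real (Suc n)"
  have a: "?a > 0" by simp
  have "real_of_int \<lfloor>?a * s\<rfloor> \<le> ?a * s" "?a * s < real_of_int \<lfloor>?a * s\<rfloor> + 1"
    by linarith+
  then show "real_of_int \<lfloor>?a * s\<rfloor> / ?a \<le> s" "s < real_of_int \<lfloor>?a * s\<rfloor> / ?a + 1 / ?a"
    using a by (simp_all add: pos_divide_le_eq pos_less_divide_eq add_divide_distrib[symmetric] mult.commute del: of_nat_Suc)
  show "0 \<le> real_of_int \<lfloor>?a * s\<rfloor> / ?a"
    using assms by simp
qed

lemma sampled_path_converges:
  assumes "cadlag x"
  shows "converges_at_continuity_points (\<lambda>n. sampled_path n x) x"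
  unfolding converges_at_continuity_points_def
proof (intro conjI allI impI)
  fix T
  obtain B where "\<And>s. 0 \<le> s \<Longrightarrow> s \<le> T \<Longrightarrow> \<bar>x s\<bar> \<le> B"
    using cadlag_bounded[OF assms] by blast
  then have "\<bar>sampled_path n x s\<bar> \<le> B" if "0 \<le> s" "s \<le> T" for n s
    unfolding sampled_path_def using sampling_time(1,2)[OF that(1), of n] that(2) by simp
  then show "\<exists>B. \<forall>\<^sub>F n in sequentially. \<forall>s. 0 \<le> s \<and> s \<le> T \<longrightarrow> \<bar>sampled_path n x s\<bar> \<le> B"
    by (intro exI[of _ B]) simp
next
  fix s e :: real assume "s \<ge> 0" "s \<notin> discontinuities x" "e > 0"
  then obtain d where d: "d > 0" "\<And>r. 0 \<le> r \<Longrightarrow> \<bar>r - s\<bar> < d \<Longrightarrow> \<bar>x r - x s\<bar> < e"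
    using continuous_nearby by blast
  have "\<forall>\<^sub>F n in sequentially. 1 / real (Suc n) < d / 2"
    using d(1) by (intro order_tendstoD(2)[OF LIMSEQ_Suc[OF lim_1_over_n]]) auto
  then have "\<forall>\<^sub>F n in sequentially. \<forall>r. 0 \<le> r \<and> \<bar>r - s\<bar> < d / 2 \<longrightarrow> \<bar>sampled_path n x r - x s\<bar> < e"
  proof eventually_elim
    case (elim n)
    show ?case
    proof (intro allI impI)
      fix r assume r: "0 \<le> r \<and> \<bar>r - s\<bar> < d / 2"
      note sampling_time[OF conjunct1[OF r], of n]
      with r elim have "\<bar>real_of_int \<lfloor>real (Suc n) * r\<rfloor> / real (Suc n) - s\<bar> < d" by linarith
      with \<open>0 \<le> real_of_int \<lfloor>real (Suc n) * r\<rfloor> / real (Suc n)\<close>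
      show "\<bar>sampled_path n x r - x s\<bar> < e"
        unfolding sampled_path_def by (intro d(2))
    qed
  qed
  then show "\<exists>d>0. \<forall>\<^sub>F n in sequentially. \<forall>r. 0 \<le> r \<and> \<bar>r - s\<bar> < d \<longrightarrow> \<bar>sampled_path n x r - x s\<bar> < e"
    using d(1) by (intro exI[of _ "d / 2"]) simp
qed

lemma batch_variance_sampled_path_tendsto:
  assumes "cadlag x" "t \<ge> 0"
  shows "(\<lambda>n. batch_variance m (sampled_path n x) t) \<longlonglongrightarrow> batch_variance m x t"
proof (rule batch_variance_tendsto[OF sampled_path_converges[OF assms(1)] assms(1) _ tendsto_const assms(2)])
  fix n
  define y where "y s = x (max 0 s)" for s
  have [measurable]: "y \<in> borel_measurable borel"
    using cadlag_borel_measurable[OF assms(1)] by (simp add: y_def[abs_def])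
  have "(\<lambda>s. sampled_path n x (max 0 s))
      = (\<lambda>s. y (real_of_int \<lfloor>real (Suc n) * max 0 s\<rfloor> / real (Suc n)))"
    using sampling_time(1)[of "max 0 _" n] by (simp add: sampled_path_def y_def max_absorb2 del: of_nat_Suc)
  then show "(\<lambda>s. sampled_path n x (max 0 s)) \<in> borel_measurable borel"
    by (simp del: of_nat_Suc) measurable
qed

text \<open>The sampled path at time \<open>s\<close> looks only at times \<open>\<le> s\<close>, which is what adaptedness requires.\<close>

lemma batch_variance_sampled_path_measurable:
  assumes X: "\<And>s. 0 \<le> s \<Longrightarrow> s \<le> t \<Longrightarrow> X s \<in> borel_measurable K" and "t \<ge> 0"
  shows "(\<lambda>\<omega>. batch_variance m (sampled_path n (\<lambda>s. X s \<omega>)) t) \<in> borel_measurable K"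
proof -
  define a where "a = real (Suc n)"
  \<comment> \<open>Cutting off outside \<open>[0,t]\<close> makes \<open>G j\<close> measurable for every integer \<open>j\<close>, so that the sampled
    path becomes a countable family of measurable functions with a measurable index.\<close>
  define G where "G j \<omega> = (if 0 \<le> real_of_int j / a \<and> real_of_int j / a \<le> t then X (real_of_int j / a) \<omega> else 0)"
    for j \<omega>
  have G: "G j \<in> borel_measurable K" for j
    unfolding G_def[abs_def] using X by (cases "0 \<le> real_of_int j / a \<and> real_of_int j / a \<le> t") auto
  have [measurable]: "(\<lambda>p. G \<lfloor>a * (c * (t * snd p))\<rfloor> (fst p)) \<in> borel_measurable (K \<Otimes>\<^sub>M lborel)" for c
    by (rule measurable_compose_countable[where f = "\<lambda>j p. G j (fst p)"])
      (auto intro!: measurable_compose[OF measurable_fst G])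
  have sampled: "sampled_path n (\<lambda>s. X s \<omega>) (c * (t * u)) = G \<lfloor>a * (c * (t * u))\<rfloor> \<omega>"
    if "0 \<le> c" "c \<le> 1" "u \<in> {0..1}" for c u \<omega>
  proof -
    have "c * (t * u) \<le> 1 * (t * 1)"
      using that assms(2) by (intro mult_mono) auto
    moreover have "0 \<le> c * (t * u)" using that assms(2) by simp
    ultimately show ?thesis
      using sampling_time(1,2)[of "c * (t * u)" n] by (simp add: sampled_path_def G_def a_def del: of_nat_Suc)
  qed
  have "(\<lambda>\<omega>. LINT u:{0..1}|lborel. (batch_deviation m k (sampled_path n (\<lambda>s. X s \<omega>)) (t * u))\<^sup>2)
      \<in> borel_measurable K" if k: "k \<in> {1..m}" for k
  proof -
    have "indicator {0..1} u *\<^sub>R (batch_deviation m k (sampled_path n (\<lambda>s. X s \<omega>)) (t * u))\<^sup>2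
        = indicator {0..1} u *\<^sub>R (G \<lfloor>a * (real k / real m * (t * u))\<rfloor> \<omega>
          - G \<lfloor>a * ((real k - 1) / real m * (t * u))\<rfloor> \<omega> - 1 / real m * G \<lfloor>a * (1 * (t * u))\<rfloor> \<omega>)\<^sup>2" for u \<omega>
      using k sampled[of "real k / real m" u \<omega>] sampled[of "(real k - 1) / real m" u \<omega>] sampled[of 1 u \<omega>]
      by (cases "u \<in> {0..1}") (simp_all add: batch_deviation_def)
    then have "(\<lambda>\<omega>. LINT u:{0..1}|lborel. (batch_deviation m k (sampled_path n (\<lambda>s. X s \<omega>)) (t * u))\<^sup>2)
        = (\<lambda>\<omega>. \<integral>u. indicator {0..1} u *\<^sub>R (G \<lfloor>a * (real k / real m * (t * u))\<rfloor> \<omega>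
          - G \<lfloor>a * ((real k - 1) / real m * (t * u))\<rfloor> \<omega> - 1 / real m * G \<lfloor>a * (1 * (t * u))\<rfloor> \<omega>)\<^sup>2 \<partial>lborel)"
      by (simp only: set_lebesgue_integral_def)
    also have "\<dots> \<in> borel_measurable K"
      by (rule lborel.borel_measurable_lebesgue_integral) (unfold split_beta', measurable)
    finally show ?thesis .
  qed
  then show ?thesis
    unfolding batch_variance_def by (intro borel_measurable_times borel_measurable_sum) auto
qed

text \<open>A version of \<^const>\<open>batch_variance\<close> that is measurable on the whole path space with its product
  \<open>\<sigma>\<close>-algebra.\<close>

definition sampled_batch_variance :: "nat \<Rightarrow> real \<Rightarrow> (real \<Rightarrow> real) \<Rightarrow> real" where
  "sampled_batch_variance m t x = lim (\<lambda>n. batch_variance m (sampled_path n x) t)"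

lemma sampled_batch_variance_eq:
  "cadlag x \<Longrightarrow> t \<ge> 0 \<Longrightarrow> sampled_batch_variance m t x = batch_variance m x t"
  unfolding sampled_batch_variance_def by (rule limI[OF batch_variance_sampled_path_tendsto])

lemma sampled_batch_variance_measurable:
  assumes "\<And>s. 0 \<le> s \<Longrightarrow> s \<le> t \<Longrightarrow> X s \<in> borel_measurable K" "t \<ge> 0"
  shows "(\<lambda>\<omega>. sampled_batch_variance m t (\<lambda>s. X s \<omega>)) \<in> borel_measurable K"
  unfolding sampled_batch_variance_def
  by (intro borel_measurable_lim_metric batch_variance_sampled_path_measurable assms)

text \<open>Stated for every \<open>\<sigma>\<close>-algebra \<open>K\<close> that contains the null sets, so that it serves both the completion
  and the members of the augmented filtration.\<close>

lemma borel_measurable_AE_cong: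
  fixes f g :: "'a \<Rightarrow> real"
  assumes "space K = space N" "null_sets (completion N) \<subseteq> sets K" "f \<in> borel_measurable K"
    and ae: "AE \<omega> in N. f \<omega> = g \<omega>"
  shows "g \<in> borel_measurable K"
proof (rule measurableI)
  fix B :: "real set" assume B: "B \<in> sets borel"
  let ?E = "{\<omega> \<in> space N. f \<omega> \<noteq> g \<omega>}"
  have E: "?E \<in> null_sets (completion N)"
    using AE_completion[OF ae] by (simp add: completion.AE_iff_null_sets)
  have "g -` B \<inter> space K = (f -` B \<inter> space K - ?E) \<union> (?E \<inter> g -` B)"
    using assms(1) by auto
  moreover have "?E \<inter> g -` B \<in> null_sets (completion N)"
    by (rule completion.complete2[OF _ E]) auto
  ultimately have "?E \<in> sets K" "?E \<inter> g -` B \<in> sets K" and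
    eq: "g -` B \<inter> space K = (f -` B \<inter> space K - ?E) \<union> (?E \<inter> g -` B)"
    using E assms(2) by (blast+)
  then show "g -` B \<inter> space K \<in> sets K"
    unfolding eq using measurable_sets[OF assms(3) B] by (intro sets.Un sets.Diff)
qed simp

text \<open>Almost everywhere equal functions are both measurable for the completion or both not, and in the
  second case both integrals have the default value \<open>0\<close>. This covers test
  functions of sample paths of which only continuity in \<open>M\<^sub>2\<close> is known.\<close>

lemma integral_completion_cong_AE:
  fixes f g :: "'a \<Rightarrow> real"
  assumes ae: "AE \<omega> in N. f \<omega> = g \<omega>"
  shows "(\<integral>\<omega>. f \<omega> \<partial>completion N) = (\<integral>\<omega>. g \<omega> \<partial>completion N)"
proof (cases "f \<in> borel_measurable (completion N)")
  case True
  moreover have "g \<in> borel_measurable (completion N)"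
    by (rule borel_measurable_AE_cong[OF _ _ True ae]) auto
  ultimately show ?thesis
    using AE_completion[OF ae] by (intro integral_cong_AE) auto
next
  case False
  moreover have "g \<notin> borel_measurable (completion N)"
  proof
    assume g: "g \<in> borel_measurable (completion N)"
    have "AE \<omega> in N. g \<omega> = f \<omega>" using ae by eventually_elim simp
    then have "f \<in> borel_measurable (completion N)"
      by (intro borel_measurable_AE_cong[OF _ _ g]) auto
    with False show False ..
  qed
  ultimately show ?thesis
    using borel_measurable_integrable not_integrable_integral_eq by metis
qed

section \<open>The batch-means process\<close>

lemma AE_batch_means_average:
  assumes "AE \<omega> in N. X 0 \<omega> = 0"
  shows "AE \<omega> in N. \<forall>t\<ge>0. batch_means_average m X t \<omega> = batch_variance m (\<lambda>s. X s \<omega>) t"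
  using assms by eventually_elim (auto intro: batch_means_average_eq_batch_variance)

lemma batch_variance_version_measurable:
  assumes X: "D_process N X" and "t \<ge> 0"
    and W: "AE \<omega> in N. \<forall>t\<ge>0. W t \<omega> = batch_variance m (\<lambda>s. X s \<omega>) t"
    and K: "space K = space N" "null_sets (completion N) \<subseteq> sets K"
      "\<And>s. 0 \<le> s \<Longrightarrow> s \<le> t \<Longrightarrow> X s \<in> borel_measurable K"
  shows "W t \<in> borel_measurable K"
proof (rule borel_measurable_AE_cong[OF K(1,2)])
  show "(\<lambda>\<omega>. sampled_batch_variance m t (\<lambda>s. X s \<omega>)) \<in> borel_measurable K"
    by (intro sampled_batch_variance_measurable K assms(2))
  have "AE \<omega> in N. cadlag (\<lambda>t. X t \<omega>)" using X by (simp add: D_process_def)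
  with W show "AE \<omega> in N. sampled_batch_variance m t (\<lambda>s. X s \<omega>) = W t \<omega>"
    by eventually_elim (use assms(2) in \<open>simp add: sampled_batch_variance_eq\<close>)
qed

lemma AE_continuous_batch_means_average:
  assumes "D_process N X" "AE \<omega> in N. X 0 \<omega> = 0"
  shows "AE \<omega> in N. continuous_on {0..} (\<lambda>t. batch_means_average m X t \<omega>)"
proof -
  have "AE \<omega> in N. cadlag (\<lambda>t. X t \<omega>)" using assms(1) by (simp add: D_process_def)
  with AE_batch_means_average[where X = X, OF assms(2), of m] show ?thesis
  proof eventually_elim
    case (elim \<omega>)
    show ?case
      by (rule continuous_on_eq[OF batch_variance_continuous[OF elim(2), of m]]) (use elim(1) in simp)
  qed
qed

lemma D_plus_process_batch_means_average:
  assumes "D_process N X" "AE \<omega> in N. X 0 \<omega> = 0" "m \<ge> 1"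
  shows "D_plus_process N (batch_means_average m X)"
  unfolding D_plus_process_def D_process_def
proof (intro conjI allI impI)
  fix t :: real assume "t \<ge> 0"
  then show "batch_means_average m X t \<in> borel_measurable (completion N)"
    by (rule batch_variance_version_measurable[OF assms(1) _ AE_batch_means_average[where X = X, OF assms(2)]])
      (use assms(1) in \<open>auto simp: D_process_def\<close>)
next
  show "AE \<omega> in N. cadlag (\<lambda>t. batch_means_average m X t \<omega>)"
    using AE_continuous_batch_means_average[OF assms(1,2), of m] by eventually_elim (rule continuous_imp_cadlag)
  show "AE \<omega> in N. \<forall>t\<ge>0. 0 \<le> batch_means_average m X t \<omega>"
    using AE_batch_means_average[where X = X, OF assms(2), of m]
    by eventually_elim (use assms(3) in \<open>simp add: batch_variance_nonneg\<close>)
qed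

text \<open>Up to null sets, the time average at time \<open>s\<close> is a function of the path of \<open>X\<close> on \<open>[0,s]\<close>. This
  identifies the \<open>\<sigma>\<close>-algebras of both filtrations already at each time \<open>u\<close>, before they are made
  right-continuous.\<close>

lemma augmented_natural_filtration_batch_means:
  assumes "D_process N X" "AE \<omega> in N. X 0 \<omega> = 0"
  shows "augmented_natural_filtration N (\<lambda>t \<omega>. (X t \<omega>, batch_means_average m X t \<omega>))
    = augmented_natural_filtration N X"
proof -
  define P where "P t \<omega> = (X t \<omega>, batch_means_average m X t \<omega>)" for t \<omega>
  define gX where "gX u = {X s -` B \<inter> space N | s B. 0 \<le> s \<and> s \<le> u \<and> B \<in> sets borel}
      \<union> null_sets (completion N)" for u
  define gP where "gP u = {P s -` B \<inter> space N | s B. 0 \<le> s \<and> s \<le> u \<and> B \<in> sets borel}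
      \<union> null_sets (completion N)" for u
  have null: "A \<subseteq> space N" if "A \<in> null_sets (completion N)" for A
    using sets.sets_into_space[of A "completion N"] that by auto
  have "sigma_sets (space N) (gP u) = sigma_sets (space N) (gX u)" for u
  proof
    define K where "K = sigma (space N) (gX u)"
    have sub: "gX u \<subseteq> Pow (space N)" using null by (auto simp: gX_def)
    have K: "space K = space N" "sets K = sigma_sets (space N) (gX u)"
      using sub by (auto simp: K_def space_measure_of_conv sets_measure_of_conv)
    have null_K: "null_sets (completion N) \<subseteq> sets K"
      by (auto simp: K gX_def intro: sigma_sets.Basic)
    have X_K: "X s \<in> borel_measurable K" if "0 \<le> s" "s \<le> u" for s
    proof (rule measurableI)
      fix B :: "real set" assume "B \<in> sets borel"
      then have "X s -` B \<inter> space N \<in> gX u" using that by (auto simp: gX_def)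
      then show "X s -` B \<inter> space K \<in> sets K" by (auto simp: K intro: sigma_sets.Basic)
    qed simp
    have P_K: "P s \<in> borel_measurable K" if s: "0 \<le> s" "s \<le> u" for s
    proof -
      have "batch_means_average m X s \<in> borel_measurable K"
        by (rule batch_variance_version_measurable[OF assms(1) s(1) AE_batch_means_average[where X = X, OF assms(2)] K(1) null_K])
          (use X_K s in auto)
      with X_K[OF s] show ?thesis
        unfolding P_def[abs_def] by (rule borel_measurable_Pair)
    qed
    show "sigma_sets (space N) (gP u) \<subseteq> sigma_sets (space N) (gX u)"
    proof (rule sigma_sets_mono, rule subsetI)
      fix A assume "A \<in> gP u"
      then show "A \<in> sigma_sets (space N) (gX u)"
        unfolding gP_def K(2)[symmetric] using null_K measurable_sets[OF P_K] by (auto simp: K(1))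
    qed
    show "sigma_sets (space N) (gX u) \<subseteq> sigma_sets (space N) (gP u)"
    proof (rule sigma_sets_mono, rule subsetI)
      fix A assume "A \<in> gX u"
      moreover have "X s -` B \<inter> space N \<in> gP u" if "0 \<le> s" "s \<le> u" "B \<in> sets borel" for s and B :: "real set"
      proof -
        have "(fst -` B :: (real \<times> real) set) \<in> sets borel"
          using measurable_sets[OF borel_measurable_continuous_onI[OF continuous_on_fst[OF continuous_on_id]] that(3)] by simp
        moreover have "X s -` B \<inter> space N = P s -` (fst -` B) \<inter> space N" by (auto simp: P_def)
        ultimately show ?thesis using that(1,2) unfolding gP_def by blast
      qed
      moreover have "null_sets (completion N) \<subseteq> gP u" by (simp add: gP_def)
      ultimately have "A \<in> gP u" unfolding gX_def by blast
      then show "A \<in> sigma_sets (space N) (gP u)" by (rule sigma_sets.Basic)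
    qed
  qed
  then show ?thesis
    unfolding augmented_natural_filtration_def P_def[symmetric] gP_def[symmetric] gX_def[symmetric]
    by simp
qed

section \<open>Laws and self-similarity\<close>

lemma sample_path_measurable:
  assumes "\<And>t. t \<ge> 0 \<Longrightarrow> X t \<in> borel_measurable K"
  shows "sample_path X \<in> measurable K (PiM {0..} (\<lambda>_. borel))"
  unfolding sample_path_def[abs_def] by (rule measurable_restrict) (use assms in auto)

text \<open>The map of path space on the right depends only on \<open>m\<close>. Processes with equal laws therefore
  have equal joint laws with their batch-means variances, which is how self-similarity passes to the
  pair.\<close>

lemma process_law_with_batch_variance:
  assumes X: "D_process N X"
    and W: "AE \<omega> in N. \<forall>t\<ge>0. W t \<omega> = batch_variance m (\<lambda>s. X s \<omega>) t"
  shows "process_law N (\<lambda>t \<omega>. (X t \<omega>, W t \<omega>)) =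
    distr (process_law N X) (PiM {0..} (\<lambda>_. borel)) (\<lambda>x. \<lambda>t\<in>{0..}. (x t, sampled_batch_variance m t x))"
    (is "_ = distr _ _ ?g")
proof -
  have X_meas: "X t \<in> borel_measurable (completion N)" if "t \<ge> 0" for t
    using X that by (simp add: D_process_def)
  have W_meas: "W t \<in> borel_measurable (completion N)" if "t \<ge> 0" for t
    by (rule batch_variance_version_measurable[OF X that W]) (auto intro: X_meas)
  have g: "?g \<in> measurable (PiM {0..} (\<lambda>_. borel)) (PiM {0..} (\<lambda>_. borel))"
  proof (rule measurable_restrict)
    fix t :: real assume t: "t \<in> {0..}"
    have "(\<lambda>x. sampled_batch_variance m t (\<lambda>s. x s)) \<in> borel_measurable (PiM {0..} (\<lambda>_. borel))"
      using t by (intro sampled_batch_variance_measurable measurable_component_singleton) auto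
    then show "(\<lambda>x. (x t, sampled_batch_variance m t x)) \<in> borel_measurable (PiM {0..} (\<lambda>_. borel))"
      using t by (intro borel_measurable_Pair measurable_component_singleton) auto
  qed
  have sX: "sample_path X \<in> measurable (completion N) (PiM {0..} (\<lambda>_. borel))"
    by (rule sample_path_measurable[OF X_meas])
  have "AE \<omega> in N. cadlag (\<lambda>t. X t \<omega>)" using X by (simp add: D_process_def)
  with W have "AE \<omega> in N. sample_path (\<lambda>t \<omega>. (X t \<omega>, W t \<omega>)) \<omega> = (?g \<circ> sample_path X) \<omega>"
  proof eventually_elim
    case (elim \<omega>)
    have c: "cadlag (sample_path X \<omega>)"
      unfolding sample_path_def using elim(2) by (simp add: cadlag_restrict)
    have "W t \<omega> = sampled_batch_variance m t (sample_path X \<omega>)" if "t \<ge> 0" for t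
    proof (cases "m \<ge> 1")
      case True
      have "batch_variance m (sample_path X \<omega>) t = 1\<^sup>2 * batch_variance m (\<lambda>s. X s \<omega>) (1 * t)"
        by (rule batch_variance_affine[where b = 0]) (use that True in \<open>auto simp: sample_path_def\<close>)
      then show ?thesis using elim(1) that sampled_batch_variance_eq[OF c that] by simp
    next
      case False
      then show ?thesis using elim(1) that sampled_batch_variance_eq[OF c that]
        by (simp add: batch_variance_def)
    qed
    then show ?case by (auto simp: sample_path_def fun_eq_iff)
  qed
  then have "distr (completion N) (PiM {0..} (\<lambda>_. borel)) (sample_path (\<lambda>t \<omega>. (X t \<omega>, W t \<omega>)))
      = distr (completion N) (PiM {0..} (\<lambda>_. borel)) (?g \<circ> sample_path X)"
    by (intro distr_cong_AE AE_completion sample_path_measurable borel_measurable_Pair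
        X_meas W_meas measurable_comp[OF sX g]) auto
  also have "\<dots> = distr (process_law N X) (PiM {0..} (\<lambda>_. borel)) ?g"
    unfolding process_law_def by (rule distr_distr[OF g sX, symmetric])
  finally show ?thesis unfolding process_law_def .
qed

lemma cadlag_time_scale:
  assumes "cadlag x" "a > 0"
  shows "cadlag (\<lambda>t. x (a * t))"
proof -
  have lim: "((*) a \<longlongrightarrow> a * t) (at t within A)" for t A
    by (intro tendsto_intros)
  have r: "filterlim ((*) a) (at_right (a * t)) (at_right t)" for t
    using assms(2) lim by (auto simp: filterlim_at eventually_at_right_field intro!: exI[of _ "t + 1"])
  have l: "filterlim ((*) a) (at_left (a * t)) (at_left t)" for t
    using assms(2) lim by (auto simp: filterlim_at eventually_at_left_field intro!: exI[of _ "t - 1"])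
  show ?thesis
    unfolding cadlag_def
  proof (intro conjI allI impI)
    fix t :: real assume "t \<ge> 0"
    then have "(x \<longlongrightarrow> x (a * t)) (at_right (a * t))" using assms by (simp add: cadlag_def)
    then show "((\<lambda>t. x (a * t)) \<longlongrightarrow> x (a * t)) (at_right t)" using r by (rule filterlim_compose)
  next
    fix t :: real assume "t > 0"
    then have "a * t > 0" using assms(2) by simp
    then obtain c where "(x \<longlongrightarrow> c) (at_left (a * t))" using assms(1) by (auto simp: cadlag_def)
    then show "\<exists>c. ((\<lambda>t. x (a * t)) \<longlongrightarrow> c) (at_left t)" using l by (blast intro: filterlim_compose)
  qed
qed

lemma cadlag_affine_drift:
  assumes "cadlag x"
  shows "cadlag (\<lambda>t. c * (x t + b * t))"
  unfolding cadlag_def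
proof (intro conjI allI impI)
  fix t :: real assume "t \<ge> 0"
  with assms show "((\<lambda>t. c * (x t + b * t)) \<longlongrightarrow> c * (x t + b * t)) (at_right t)"
    by (auto simp: cadlag_def intro!: tendsto_intros)
next
  fix t :: real assume "t > 0"
  from cadlag_tendsto_left_lim[OF assms this]
  have "((\<lambda>t. c * (x t + b * t)) \<longlongrightarrow> c * (left_lim x t + b * t)) (at_left t)"
    by (intro tendsto_intros)
  then show "\<exists>l. ((\<lambda>t. c * (x t + b * t)) \<longlongrightarrow> l) (at_left t)" by blast
qed

lemma process_law_batch_means_self_similar:
  assumes Y: "D_process N Y" "AE \<omega> in N. Y 0 \<omega> = 0" and "a > 0" "m \<ge> 1"
    and law: "process_law N (\<lambda>t. Y (a * t)) = process_law N (\<lambda>t \<omega>. a powr h * Y t \<omega>)"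
  shows "process_law N (\<lambda>t \<omega>. (Y (a * t) \<omega>, batch_means_average m Y (a * t) \<omega>))
    = process_law N (\<lambda>t \<omega>. (a powr h * Y t \<omega>, a powr (2 * h) * batch_means_average m Y t \<omega>))"
proof -
  note bm = AE_batch_means_average[where X = Y, OF Y(2), of m]
  have sq: "(a powr h)\<^sup>2 = a powr (2 * h)"
    using \<open>a > 0\<close> by (simp add: power2_eq_square powr_add[symmetric])
  have Y': "\<And>t. t \<ge> 0 \<Longrightarrow> Y t \<in> borel_measurable (completion N)" "AE \<omega> in N. cadlag (\<lambda>t. Y t \<omega>)"
    using Y(1) by (auto simp: D_process_def)
  have D1: "D_process N (\<lambda>t. Y (a * t))"
    unfolding D_process_def
  proof (intro conjI allI impI)
    show "AE \<omega> in N. cadlag (\<lambda>t. Y (a * t) \<omega>)"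
      using Y'(2) by eventually_elim (rule cadlag_time_scale[OF _ \<open>a > 0\<close>])
  qed (use Y'(1) \<open>a > 0\<close> in auto)
  have D2: "D_process N (\<lambda>t \<omega>. a powr h * Y t \<omega>)"
    unfolding D_process_def
  proof (intro conjI allI impI)
    show "AE \<omega> in N. cadlag (\<lambda>t. a powr h * Y t \<omega>)"
      using Y'(2)
    proof eventually_elim
      case (elim \<omega>)
      show ?case using cadlag_affine_drift[OF elim, of "a powr h" 0] by simp
    qed
  qed (use Y'(1) in auto)
  have W1: "AE \<omega> in N. \<forall>t\<ge>0. batch_means_average m Y (a * t) \<omega> = batch_variance m (\<lambda>s. Y (a * s) \<omega>) t"
    using bm
  proof eventually_elim
    case (elim \<omega>)
    show ?case
    proof (intro allI impI)
      fix t :: real assume t: "t \<ge> 0"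
      have "batch_variance m (\<lambda>s. Y (a * s) \<omega>) t = 1\<^sup>2 * batch_variance m (\<lambda>s. Y s \<omega>) (a * t)"
        by (rule batch_variance_affine[where b = 0]) (use t assms(4) in auto)
      then show "batch_means_average m Y (a * t) \<omega> = batch_variance m (\<lambda>s. Y (a * s) \<omega>) t"
        using elim t \<open>a > 0\<close> by simp
    qed
  qed
  have W2: "AE \<omega> in N. \<forall>t\<ge>0. a powr (2 * h) * batch_means_average m Y t \<omega>
      = batch_variance m (\<lambda>s. a powr h * Y s \<omega>) t"
    using bm
  proof eventually_elim
    case (elim \<omega>)
    show ?case
    proof (intro allI impI)
      fix t :: real assume t: "t \<ge> 0"
      have "batch_variance m (\<lambda>s. a powr h * Y s \<omega>) t = (a powr h)\<^sup>2 * batch_variance m (\<lambda>s. Y s \<omega>) (1 * t)"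
        by (rule batch_variance_affine[where b = 0]) (use t assms(4) in auto)
      then show "a powr (2 * h) * batch_means_average m Y t \<omega> = batch_variance m (\<lambda>s. a powr h * Y s \<omega>) t"
        using elim t sq by simp
    qed
  qed
  show ?thesis
    unfolding process_law_with_batch_variance[OF D1 W1] process_law_with_batch_variance[OF D2 W2] law ..
qed

lemma distr_process_law_component:
  assumes "\<And>t. t \<ge> 0 \<Longrightarrow> X t \<in> borel_measurable (completion N)" "t \<ge> 0"
  shows "distr (process_law N X) borel (\<lambda>x. x t) = distr (completion N) borel (X t)"
proof -
  have "distr (process_law N X) borel (\<lambda>x. x t) = distr (completion N) borel ((\<lambda>x. x t) \<circ> sample_path X)"
    unfolding process_law_def
    by (intro distr_distr sample_path_measurable assms measurable_component_singleton) (use assms(2) in auto)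
  also have "(\<lambda>x. x t) \<circ> sample_path X = X t"
    using assms(2) by (auto simp: sample_path_def)
  finally show ?thesis .
qed

text \<open>The law of \<open>Y 0\<close> is invariant under all positive scalings, so the mass it gives to
  \<open>{\<bar>y\<bar> > c}\<close> does not depend on \<open>c > 0\<close>; letting \<open>c \<rightarrow> \<infinity>\<close> shows that it vanishes.\<close>

lemma self_similar_AE_zero_at_zero:
  assumes "prob_space N" and Y: "D_process N Y" and "h > 0"
    and law: "\<And>a. a > 0 \<Longrightarrow> process_law N (\<lambda>t. Y (a * t)) = process_law N (\<lambda>t \<omega>. a powr h * Y t \<omega>)"
  shows "AE \<omega> in N. Y 0 \<omega> = 0"
proof -
  interpret prob_space N by fact
  interpret C: prob_space "completion N"
    by standard (simp add: emeasure_space_1)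
  have Y_meas: "\<And>t. t \<ge> 0 \<Longrightarrow> Y t \<in> borel_measurable (completion N)"
    using Y by (auto simp: D_process_def)
  note [measurable] = Y_meas[of 0, simplified]
  have events: "{\<omega> \<in> space N. \<bar>Y 0 \<omega>\<bar> > c} \<in> C.events" for c
  proof -
    have "{\<omega> \<in> space (completion N). \<bar>Y 0 \<omega>\<bar> > c} \<in> C.events" by measurable
    then show ?thesis by simp
  qed
  have scale: "C.prob {\<omega> \<in> space N. \<bar>Y 0 \<omega>\<bar> > c} = C.prob {\<omega> \<in> space N. \<bar>Y 0 \<omega>\<bar> > c / b}"
    if "b > 0" for b c
  proof -
    define a where "a = b powr (1 / h)"
    have a: "a > 0" "a powr h = b" using that \<open>h > 0\<close> by (auto simp: a_def powr_powr)
    have "distr (completion N) borel (Y (a * 0)) = distr (completion N) borel (\<lambda>\<omega>. a powr h * Y 0 \<omega>)"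
      using distr_process_law_component[of "\<lambda>t. Y (a * t)" N 0]
        distr_process_law_component[of "\<lambda>t \<omega>. a powr h * Y t \<omega>" N 0] Y_meas a law[OF a(1)] by simp
    then have "measure (distr (completion N) borel (Y 0)) {y. \<bar>y\<bar> > c}
        = measure (distr (completion N) borel (\<lambda>\<omega>. b * Y 0 \<omega>)) {y. \<bar>y\<bar> > c}"
      using a by simp
    then have "C.prob {\<omega> \<in> space N. \<bar>Y 0 \<omega>\<bar> > c} = C.prob {\<omega> \<in> space N. \<bar>b * Y 0 \<omega>\<bar> > c}"
      by (simp add: measure_distr vimage_def Int_def conj_commute)
    also have "{\<omega> \<in> space N. \<bar>b * Y 0 \<omega>\<bar> > c} = {\<omega> \<in> space N. \<bar>Y 0 \<omega>\<bar> > c / b}"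
      using that by (auto simp: abs_mult pos_divide_less_eq mult.commute)
    finally show ?thesis .
  qed
  have "(\<lambda>n. C.prob {\<omega> \<in> space N. \<bar>Y 0 \<omega>\<bar> > real n}) \<longlonglongrightarrow> C.prob (\<Inter>n. {\<omega> \<in> space N. \<bar>Y 0 \<omega>\<bar> > real n})"
    by (rule C.finite_Lim_measure_decseq) (auto simp: decseq_def intro: events)
  moreover have "(\<Inter>n. {\<omega> \<in> space N. \<bar>Y 0 \<omega>\<bar> > real n}) = {}"
    using reals_Archimedean2 by (auto simp: not_less less_le_not_le)
  moreover have "\<forall>\<^sub>F n in sequentially. C.prob {\<omega> \<in> space N. \<bar>Y 0 \<omega>\<bar> > real n} = C.prob {\<omega> \<in> space N. \<bar>Y 0 \<omega>\<bar> > 1}"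
    using eventually_gt_at_top[of 0] by eventually_elim (use scale[of "1 / real _" 1] in auto)
  ultimately have "(\<lambda>n::nat. C.prob {\<omega> \<in> space N. \<bar>Y 0 \<omega>\<bar> > 1}) \<longlonglongrightarrow> 0"
    by (simp add: tendsto_cong)
  then have one: "C.prob {\<omega> \<in> space N. \<bar>Y 0 \<omega>\<bar> > 1} = 0"
    by (simp add: LIMSEQ_const_iff)
  have "AE \<omega> in completion N. \<not> \<bar>Y 0 \<omega>\<bar> > 1 / real (Suc n)" for n
  proof -
    have "C.prob {\<omega> \<in> space N. \<bar>Y 0 \<omega>\<bar> > 1 / real (Suc n)} = 0"
      using scale[of "real (Suc n)" 1] one by simp
    then show ?thesis
      using C.prob_eq_0[OF events] by (auto elim: eventually_mono)
  qed
  then have "AE \<omega> in completion N. \<forall>n. \<not> \<bar>Y 0 \<omega>\<bar> > 1 / real (Suc n)"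
    by (simp add: AE_all_countable)
  then have "AE \<omega> in completion N. Y 0 \<omega> = 0"
  proof eventually_elim
    case (elim \<omega>)
    show ?case
    proof (rule ccontr)
      assume "Y 0 \<omega> \<noteq> 0"
      then have "\<bar>Y 0 \<omega>\<bar> > 0" by simp
      then obtain n where "1 / real (Suc n) < \<bar>Y 0 \<omega>\<bar>" by (rule nat_approx_posE)
      then show False using elim by blast
    qed
  qed
  then show ?thesis by (simp add: AE_completion_iff)
qed

section \<open>Growth and positivity\<close>

text \<open>Centring removes the drift, and rescaling time by \<open>T\<close> turns the claim into the convergence of
  \<open>(z (T s) - \<mu> T s) / T\<close> to the zero path.\<close>

lemma batch_variance_over_square_tendsto_0:
  assumes z: "cadlag z" and lim: "((\<lambda>t. (z t - \<mu> * t) / t) \<longlongrightarrow> 0) at_top" and "m \<ge> 1"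
  shows "((\<lambda>t. batch_variance m z t / t\<^sup>2) \<longlongrightarrow> 0) at_top"
proof (rule tendsto_at_topI_sequentially)
  fix T :: "nat \<Rightarrow> real" assume T: "filterlim T at_top sequentially"
  \<comment> \<open>Only large times matter; the cut-off at \<open>1\<close> allows division by \<open>\<tau> n\<close> for every \<open>n\<close>.\<close>
  define \<tau> where "\<tau> n = max 1 (T n)" for n
  have \<tau>: "\<tau> n \<ge> 1" for n by (simp add: \<tau>_def)
  have \<tau>_T: "\<forall>\<^sub>F n in sequentially. \<tau> n = T n"
    using filterlim_at_top[THEN iffD1, OF T, rule_format, of 1] by eventually_elim (simp add: \<tau>_def)
  have \<tau>_lim: "filterlim \<tau> at_top sequentially"
    by (rule filterlim_at_top_mono[OF T]) (simp add: \<tau>_def)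
  define w where "w t = 1 * (z t + (- \<mu>) * t)" for t
  have w: "cadlag w" unfolding w_def[abs_def] by (rule cadlag_affine_drift[OF z])
  define ys where "ys n s = 1 / \<tau> n * w (\<tau> n * s)" for n s
  have linear_bound: "\<exists>B\<ge>0. \<forall>n s. 0 \<le> s \<longrightarrow> \<bar>ys n s\<bar> \<le> \<delta> * s + B / \<tau> n" if \<delta>: "\<delta> > 0" for \<delta>
  proof -
    have "\<forall>\<^sub>F t in at_top. dist ((z t - \<mu> * t) / t) 0 < \<delta>"
      using lim \<delta> by (rule tendstoD)
    then obtain A where A: "\<And>t. t \<ge> A \<Longrightarrow> \<bar>(z t - \<mu> * t) / t\<bar> < \<delta>"
      by (auto simp: eventually_at_top_linorder dist_real_def)
    obtain B where B: "\<And>s. 0 \<le> s \<Longrightarrow> s \<le> max 1 A \<Longrightarrow> \<bar>w s\<bar> \<le> B"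
      using cadlag_bounded[OF w] by blast
    have "\<bar>w 0\<bar> \<le> B" by (rule B) auto
    then have "B \<ge> 0" by linarith
    have w_bound: "\<bar>w t\<bar> \<le> \<delta> * t + B" if "t \<ge> 0" for t
    proof (cases "t \<le> max 1 A")
      case True
      have "0 \<le> \<delta> * t" using \<delta> that by simp
      then show ?thesis using B[OF that True] by linarith
    next
      case False
      then have "\<bar>z t - \<mu> * t\<bar> / t < \<delta>" "t > 0" using A[of t] by auto
      then have "\<bar>w t\<bar> < \<delta> * t" by (simp add: w_def divide_less_eq)
      with \<open>B \<ge> 0\<close> show ?thesis by linarith
    qed
    have "\<bar>ys n s\<bar> \<le> \<delta> * s + B / \<tau> n" if "0 \<le> s" for n s
    proof -
      have "\<bar>w (\<tau> n * s)\<bar> \<le> \<delta> * (\<tau> n * s) + B" using \<tau>[of n] that by (intro w_bound) simp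
      then have "\<bar>w (\<tau> n * s)\<bar> / \<tau> n \<le> (\<delta> * (\<tau> n * s) + B) / \<tau> n"
        using \<tau>[of n] by (intro divide_right_mono) auto
      moreover have "(\<delta> * (\<tau> n * s) + B) / \<tau> n = \<delta> * s + B / \<tau> n"
        using \<tau>[of n] by (simp add: field_simps)
      moreover have "\<bar>ys n s\<bar> = \<bar>w (\<tau> n * s)\<bar> / \<tau> n"
        using \<tau>[of n] by (simp add: ys_def abs_mult)
      ultimately show ?thesis by simp
    qed
    with \<open>B \<ge> 0\<close> show ?thesis by blast
  qed
  have "converges_at_continuity_points ys (\<lambda>_. 0)"
    unfolding converges_at_continuity_points_def
  proof (intro conjI allI impI)
    fix S :: real
    obtain B where B: "B \<ge> 0" "\<And>n s. 0 \<le> s \<Longrightarrow> \<bar>ys n s\<bar> \<le> 1 * s + B / \<tau> n"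
      using linear_bound[of 1] by auto
    have "\<bar>ys n s\<bar> \<le> S + B" if "0 \<le> s" "s \<le> S" for n s
    proof -
      have "B / \<tau> n \<le> B / 1" using B(1) \<tau>[of n] by (intro divide_left_mono) auto
      then show ?thesis using B(2)[of s n] that by simp
    qed
    then show "\<exists>B. \<forall>\<^sub>F n in sequentially. \<forall>s. 0 \<le> s \<and> s \<le> S \<longrightarrow> \<bar>ys n s\<bar> \<le> B"
      by (intro exI[of _ "S + B"]) simp
  next
    fix s e :: real assume s: "0 \<le> s" and e: "0 < e"
    \<comment> \<open>With this slope \<open>\<delta> * r \<le> e / 2\<close> for all \<open>r\<close> at distance at most \<open>1\<close> from \<open>s\<close>.\<close>
    define \<delta> where "\<delta> = e / (2 * (s + 1))"
    have \<delta>: "\<delta> > 0" using s e by (simp add: \<delta>_def)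
    obtain B where B: "B \<ge> 0" "\<And>n s. 0 \<le> s \<Longrightarrow> \<bar>ys n s\<bar> \<le> \<delta> * s + B / \<tau> n"
      using linear_bound[OF \<delta>] by auto
    have "(\<lambda>n. B / \<tau> n) \<longlonglongrightarrow> 0"
      by (intro real_tendsto_divide_at_top[OF tendsto_const \<tau>_lim])
    then have "\<forall>\<^sub>F n in sequentially. B / \<tau> n < e / 2"
      using e by (intro order_tendstoD(2)) auto
    then have "\<forall>\<^sub>F n in sequentially. \<forall>r. 0 \<le> r \<and> \<bar>r - s\<bar> < 1 \<longrightarrow> \<bar>ys n r - 0\<bar> < e"
    proof eventually_elim
      case (elim n)
      show ?case
      proof (intro allI impI)
        fix r assume r: "0 \<le> r \<and> \<bar>r - s\<bar> < 1"
        then have "\<delta> * r \<le> \<delta> * (s + 1)" using \<delta> by (intro mult_left_mono) auto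
        also have "\<dots> = e / 2" using s by (simp add: \<delta>_def field_simps)
        finally have "\<delta> * r \<le> e / 2" .
        moreover have "\<bar>ys n r\<bar> \<le> \<delta> * r + B / \<tau> n" using B(2) r by blast
        ultimately show "\<bar>ys n r - 0\<bar> < e" using elim by linarith
      qed
    qed
    then show "\<exists>d>0. \<forall>\<^sub>F n in sequentially. \<forall>r. 0 \<le> r \<and> \<bar>r - s\<bar> < d \<longrightarrow> \<bar>ys n r - 0\<bar> < e"
      by (intro exI[of _ 1]) simp
  qed
  moreover have "cadlag (\<lambda>_. 0)" by (intro continuous_imp_cadlag continuous_intros)
  moreover have "(\<lambda>s. ys n (max 0 s)) \<in> borel_measurable borel" for n
  proof -
    have "cadlag (\<lambda>s. w (\<tau> n * s))"
      using w \<tau>[of n] by (intro cadlag_time_scale) auto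
    from cadlag_borel_measurable[OF this] show ?thesis
      unfolding ys_def by (intro borel_measurable_times borel_measurable_const)
  qed
  ultimately have "(\<lambda>n. batch_variance m (ys n) 1) \<longlonglongrightarrow> batch_variance m (\<lambda>_. 0) 1"
    by (rule batch_variance_tendsto) auto
  moreover have "batch_variance m (\<lambda>_. 0) 1 = 0"
    by (simp add: batch_variance_def batch_deviation_def)
  moreover have "batch_variance m (ys n) 1 = batch_variance m z (\<tau> n) / (\<tau> n)\<^sup>2" for n
  proof -
    have "batch_variance m (ys n) 1 = (1 / \<tau> n)\<^sup>2 * batch_variance m z (\<tau> n * 1)"
      by (rule batch_variance_affine[where b = "- \<mu> * \<tau> n"])
        (use assms(3) in \<open>auto simp: ys_def w_def\<close>)
    then show ?thesis by (simp add: power_divide)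
  qed
  ultimately have "(\<lambda>n. batch_variance m z (\<tau> n) / (\<tau> n)\<^sup>2) \<longlonglongrightarrow> 0" by simp
  moreover have "\<forall>\<^sub>F n in sequentially.
      batch_variance m z (\<tau> n) / (\<tau> n)\<^sup>2 = batch_variance m z (T n) / (T n)\<^sup>2"
    using \<tau>_T by eventually_elim simp
  ultimately show "(\<lambda>n. batch_variance m z (T n) / (T n)\<^sup>2) \<longlonglongrightarrow> 0"
    by (rule Lim_transform_eventually)
qed

text \<open>Without its normalisation \<open>1 / t\<close> the time average is an integral over \<open>[0,t]\<close> of a
  nonnegative function, so it is nondecreasing in \<open>t\<close>.\<close>

lemma time_batch_variance_mono:
  assumes x: "cadlag x" and "0 < r" "r \<le> t" "m \<ge> 1"
  shows "r * batch_variance m x r \<le> t * batch_variance m x t"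
proof -
  have eq: "t * batch_variance m x t
      = 1 / (real m - 1) * (\<Sum>k=1..m. LINT s:{0..t}|lborel. (batch_deviation m k x s)\<^sup>2)" if "t > 0" for t
    unfolding batch_variance_def set_integral_rescale[OF that]
    by (simp add: sum_distrib_left algebra_simps)
  obtain B where B: "\<And>s. 0 \<le> s \<Longrightarrow> s \<le> t \<Longrightarrow> \<bar>x s\<bar> \<le> B"
    using cadlag_bounded[OF x] by blast
  have "(LINT s:{0..r}|lborel. (batch_deviation m k x s)\<^sup>2) \<le> (LINT s:{0..t}|lborel. (batch_deviation m k x s)\<^sup>2)"
    if k: "k \<in> {1..m}" for k
  proof -
    have int: "integrable lborel (\<lambda>s. indicator {0..a} s *\<^sub>R (batch_deviation m k x s)\<^sup>2)" if "a \<le> t" for a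
    proof (rule Bochner_Integration.integrable_bound)
      show "integrable lborel (\<lambda>s. indicator {0..a} s * (3 * B)\<^sup>2)" by (cases "0 \<le> a") simp_all
      show "(\<lambda>s. indicator {0..a} s *\<^sub>R (batch_deviation m k x s)\<^sup>2) \<in> borel_measurable lborel"
        using batch_deviation_measurable[OF cadlag_borel_measurable[OF x], where t = 1 and k = k and m = m] k by simp
      show "AE s in lborel. norm (indicator {0..a} s *\<^sub>R (batch_deviation m k x s)\<^sup>2)
          \<le> norm (indicator {0..a} s * (3 * B)\<^sup>2)"
      proof (rule AE_I2)
        fix s :: real
        show "norm (indicator {0..a} s *\<^sub>R (batch_deviation m k x s)\<^sup>2) \<le> norm (indicator {0..a} s * (3 * B)\<^sup>2)"
          using batch_deviation_bound[OF B, where s = s and k = k and m = m] k that by (cases "s \<in> {0..a}") auto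
      qed
    qed
    show ?thesis
      unfolding set_lebesgue_integral_def
      by (rule integral_mono) (use assms int in \<open>auto simp: indicator_def\<close>)
  qed
  then have "1 / (real m - 1) * (\<Sum>k=1..m. LINT s:{0..r}|lborel. (batch_deviation m k x s)\<^sup>2)
      \<le> 1 / (real m - 1) * (\<Sum>k=1..m. LINT s:{0..t}|lborel. (batch_deviation m k x s)\<^sup>2)"
    using assms(4) by (intro mult_left_mono sum_mono) auto
  then show ?thesis using assms(2,3) eq[of r] eq[of t] by linarith
qed

section \<open>The functional limit\<close>

text \<open>Continuity at every path makes \<open>x \<mapsto> f (x, sqrt_batch_variance_path m x)\<close> a bounded continuous
  test function on the \<open>M\<^sub>2\<close> space for every such \<open>f\<close> on the product, so the weak convergence of the
  first component applies to it directly.\<close>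

lemma M2_continuous_pair:
  "continuous_map M2_topology WM2_topology (\<lambda>x. (x, sqrt_batch_variance_path m x))"
  unfolding WM2_topology_def
  by (intro continuous_map_pairedI continuous_map_sqrt_batch_variance_path continuous_map_id[unfolded id_def])

lemma sample_path_scaled_sqrt_batch_means:
  assumes "\<epsilon> > 0" "l (1 / \<epsilon>) > 0" "Z 0 \<omega> = 0" "m \<ge> 1"
  shows "sample_path (scaled_sqrt h l (batch_means_average m Z) \<epsilon>) \<omega>
    = sqrt_batch_variance_path m (sample_path (scaled_centred \<mu> h l Z \<epsilon>) \<omega>)"
proof -
  define c where "c = \<epsilon> powr h * l (1 / \<epsilon>)"
  have "c > 0" using assms by (simp add: c_def)
  have "c * sqrt (batch_means_average m Z (t / \<epsilon>) \<omega>)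
      = sqrt (batch_variance m (sample_path (scaled_centred \<mu> h l Z \<epsilon>) \<omega>) t)" if t: "t \<ge> 0" for t
  proof -
    have "batch_variance m (sample_path (scaled_centred \<mu> h l Z \<epsilon>) \<omega>) t
        = c\<^sup>2 * batch_variance m (\<lambda>s. Z s \<omega>) (1 / \<epsilon> * t)"
      by (rule batch_variance_affine[where b = "- \<mu> / \<epsilon>"])
        (use t assms(4) in \<open>auto simp: sample_path_def scaled_centred_def c_def\<close>)
    moreover have "batch_means_average m Z (t / \<epsilon>) \<omega> = batch_variance m (\<lambda>s. Z s \<omega>) (t / \<epsilon>)"
      by (rule batch_means_average_eq_batch_variance) (use t assms in auto)
    ultimately show ?thesis
      using \<open>c > 0\<close> by (simp add: real_sqrt_mult)
  qed
  then show ?thesis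
    by (auto simp: sample_path_def scaled_sqrt_def sqrt_batch_variance_path_def c_def fun_eq_iff)
qed

lemma sample_path_sqrt_batch_means:
  assumes "Y 0 \<omega> = 0" "m \<ge> 1"
  shows "sample_path (\<lambda>t \<omega>. sqrt (batch_means_average m Y t \<omega>)) \<omega>
    = sqrt_batch_variance_path m (sample_path Y \<omega>)"
proof -
  have "batch_means_average m Y t \<omega> = batch_variance m (sample_path Y \<omega>) t" if t: "t \<ge> 0" for t
  proof -
    have "batch_variance m (sample_path Y \<omega>) t = 1\<^sup>2 * batch_variance m (\<lambda>s. Y s \<omega>) (1 * t)"
      by (rule batch_variance_affine[where b = 0]) (use t assms(2) in \<open>auto simp: sample_path_def\<close>)
    then show ?thesis
      using batch_means_average_eq_batch_variance[of t Y \<omega> m] t assms(1) by simp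
  qed
  then show ?thesis
    by (auto simp: sample_path_def sqrt_batch_variance_path_def fun_eq_iff)
qed

lemma WM2_functional_limit_batch_means:
  assumes conv: "weakly_converges M2_topology M (\<lambda>\<epsilon>. sample_path (scaled_centred \<mu> h l Z \<epsilon>))
      N (sample_path Y) (at_right 0)"
    and Z: "AE \<omega> in M. Z 0 \<omega> = 0" and Y: "AE \<omega> in N. Y 0 \<omega> = 0"
    and l: "\<forall>\<^sub>F x in at_top. l x > 0" and m: "m \<ge> 1"
  shows "WM2_functional_limit M Z (batch_means_average m Z) \<mu> h l N Y (batch_means_average m Y)"
  unfolding WM2_functional_limit_def weakly_converges_def
proof (intro allI impI)
  fix f :: "(real \<Rightarrow> real) \<times> (real \<Rightarrow> real) \<Rightarrow> real"
  assume f: "continuous_map WM2_topology euclideanreal f \<and> bounded (f ` topspace WM2_topology)"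
  define g where "g x = f (x, sqrt_batch_variance_path m x)" for x
  have "continuous_map M2_topology euclideanreal g"
    using continuous_map_compose[OF M2_continuous_pair conjunct1[OF f]] by (simp add: g_def[abs_def] o_def)
  moreover have "g ` topspace M2_topology \<subseteq> f ` topspace WM2_topology"
    using sqrt_batch_variance_path_in_D_space
    by (auto simp: g_def WM2_topology_def D_space_def)
  then have "bounded (g ` topspace M2_topology)"
    using f bounded_subset by blast
  ultimately have lim: "((\<lambda>\<epsilon>. \<integral>\<omega>. g (sample_path (scaled_centred \<mu> h l Z \<epsilon>) \<omega>) \<partial>completion M)
      \<longlongrightarrow> (\<integral>\<omega>. g (sample_path Y \<omega>) \<partial>completion N)) (at_right 0)"
    using conv by (simp add: weakly_converges_def)
  have "\<forall>\<^sub>F \<epsilon> in at_right 0. l (inverse \<epsilon>) > 0"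
    using l filterlim_inverse_at_top_right by (rule eventually_compose_filterlim)
  moreover have "\<forall>\<^sub>F \<epsilon>::real in at_right 0. \<epsilon> > 0"
    by (rule eventually_at_right_less)
  ultimately have "\<forall>\<^sub>F \<epsilon> in at_right 0. (\<integral>\<omega>. g (sample_path (scaled_centred \<mu> h l Z \<epsilon>) \<omega>) \<partial>completion M)
    = (\<integral>\<omega>. f (sample_path (scaled_centred \<mu> h l Z \<epsilon>) \<omega>,
        sample_path (scaled_sqrt h l (batch_means_average m Z) \<epsilon>) \<omega>) \<partial>completion M)"
  proof eventually_elim
    case (elim \<epsilon>)
    show ?case
    proof (rule integral_completion_cong_AE, use Z in eventually_elim)
      case (elim \<omega>)
      with \<open>\<epsilon> > 0\<close> \<open>l (inverse \<epsilon>) > 0\<close> m show ?case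
        by (simp add: g_def sample_path_scaled_sqrt_batch_means[where \<mu> = \<mu>] inverse_eq_divide)
    qed
  qed
  moreover have "(\<integral>\<omega>. g (sample_path Y \<omega>) \<partial>completion N)
    = (\<integral>\<omega>. f (sample_path Y \<omega>, sample_path (\<lambda>t \<omega>. sqrt (batch_means_average m Y t \<omega>)) \<omega>) \<partial>completion N)"
  proof (rule integral_completion_cong_AE, use Y in eventually_elim)
    case (elim \<omega>)
    with m show ?case by (simp add: g_def sample_path_sqrt_batch_means)
  qed
  ultimately show "((\<lambda>\<epsilon>. \<integral>\<omega>. f (sample_path (scaled_centred \<mu> h l Z \<epsilon>) \<omega>,
        sample_path (scaled_sqrt h l (batch_means_average m Z) \<epsilon>) \<omega>) \<partial>completion M)
      \<longlongrightarrow> (\<integral>\<omega>. f (sample_path Y \<omega>, sample_path (\<lambda>t \<omega>. sqrt (batch_means_average m Y t \<omega>)) \<omega>) \<partial>completion N))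
      (at_right 0)"
    using Lim_transform_eventually[OF lim] by simp
qed

text \<open>For a single time positivity follows from the assumption at time \<open>1\<close> by self-similarity;
  monotonicity of \<open>t * Y\<^sub>2 t\<close> extends it from the times \<open>1 / n\<close> to all \<open>t > 0\<close> on one event.\<close>

lemma AE_batch_means_average_positive:
  assumes Y: "D_process N Y" "AE \<omega> in N. Y 0 \<omega> = 0" and m: "m \<ge> 2"
    and law: "\<And>a. a > 0 \<Longrightarrow> process_law N (\<lambda>t. Y (a * t)) = process_law N (\<lambda>t \<omega>. a powr h * Y t \<omega>)"
    and pos: "AE \<omega> in N. batch_means_average m Y 1 \<omega> > 0"
  shows "AE \<omega> in N. \<forall>t>0. batch_means_average m Y t \<omega> > 0"
proof -
  let ?W = "batch_means_average m Y"
  have "D_plus_process N ?W" using m by (intro D_plus_process_batch_means_average Y) simp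
  then have W_meas: "\<And>t. t \<ge> 0 \<Longrightarrow> ?W t \<in> borel_measurable (completion N)"
    and Y_meas: "\<And>t. t \<ge> 0 \<Longrightarrow> Y t \<in> borel_measurable (completion N)"
    using Y(1) by (auto simp: D_plus_process_def D_process_def)
  have at_a: "AE \<omega> in completion N. ?W a \<omega> > 0" if a: "a > 0" for a
  proof -
    let ?P = "\<lambda>t \<omega>. (Y (a * t) \<omega>, ?W (a * t) \<omega>)"
    let ?Q = "\<lambda>t \<omega>. (a powr h * Y t \<omega>, a powr (2 * h) * ?W t \<omega>)"
    have law': "process_law N ?P = process_law N ?Q"
      using m by (intro process_law_batch_means_self_similar[OF Y a _ law[OF a]]) simp
    have [measurable]: "sample_path ?P \<in> measurable (completion N) (PiM {0..} (\<lambda>_. borel))"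
      "sample_path ?Q \<in> measurable (completion N) (PiM {0..} (\<lambda>_. borel))"
      using a by (intro sample_path_measurable borel_measurable_Pair borel_measurable_times
          borel_measurable_const W_meas Y_meas; simp)+
    have comp [measurable]: "(\<lambda>x. snd (x (1::real)) :: real) \<in> borel_measurable (PiM {0..} (\<lambda>_. borel :: (real \<times> real) measure))"
    proof (rule measurable_compose[where f = "\<lambda>x. x 1" and g = snd and N = borel])
      show "(\<lambda>x. x (1::real)) \<in> measurable (PiM {0..} (\<lambda>_. borel :: (real \<times> real) measure)) borel"
        using measurable_component_singleton[of "1::real" "{0..}" "\<lambda>_. borel :: (real \<times> real) measure"]
        by simp
    qed (intro borel_measurable_continuous_onI continuous_on_snd continuous_on_id)
    have "AE x in process_law N ?Q. 0 < snd (x 1)"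
      unfolding process_law_def
      by (subst AE_distr_iff) (use AE_completion[OF pos] a in \<open>auto simp: sample_path_def elim!: eventually_mono\<close>)
    then have "AE x in process_law N ?P. 0 < snd (x 1)" by (simp only: law')
    then show ?thesis
      unfolding process_law_def by (subst (asm) AE_distr_iff) (auto simp: sample_path_def)
  qed
  have "AE \<omega> in completion N. \<forall>n. ?W (1 / real (Suc n)) \<omega> > 0"
    unfolding AE_all_countable by (intro allI at_a) simp
  then have "AE \<omega> in N. \<forall>n. ?W (1 / real (Suc n)) \<omega> > 0"
    by (simp only: AE_completion_iff)
  moreover have "AE \<omega> in N. cadlag (\<lambda>t. Y t \<omega>)" using Y(1) by (simp add: D_process_def)
  ultimately show ?thesis using AE_batch_means_average[where X = Y, OF Y(2), of m]
  proof eventually_elim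
    case (elim \<omega>)
    show ?case
    proof (intro allI impI)
      fix t :: real assume t: "t > 0"
      obtain n where n: "1 / real (Suc n) < t" using nat_approx_posE[OF t] by metis
      have r: "1 / real (Suc n) > 0" by simp
      have "0 < 1 / real (Suc n) * ?W (1 / real (Suc n)) \<omega>"
        using elim(1) r by (intro mult_pos_pos) auto
      also have "\<dots> = 1 / real (Suc n) * batch_variance m (\<lambda>s. Y s \<omega>) (1 / real (Suc n))"
        using elim(3) r by (metis less_imp_le)
      also have "\<dots> \<le> t * batch_variance m (\<lambda>s. Y s \<omega>) t"
        by (rule time_batch_variance_mono[OF elim(2) r]) (use n m in auto)
      also have "\<dots> = t * ?W t \<omega>" using elim(3) t by simp
      finally show "?W t \<omega> > 0" using t by (simp add: zero_less_mult_iff)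
    qed
  qed
qed

theorem theorem4p4:
  fixes M :: "'a measure" and N :: "'b measure"
    and Z1 :: "real \<Rightarrow> 'a \<Rightarrow> real" and Y1 :: "real \<Rightarrow> 'b \<Rightarrow> real"
    and \<mu> h :: real and l :: "real \<Rightarrow> real" and m :: nat
  assumes "prob_space M" and "prob_space N"
    and "marginal_limit_condition M Z1 \<mu> h l N Y1"
    and "m \<ge> 2"
    and "AE \<omega> in N. batch_means_average m Y1 1 \<omega> > 0"
  shows "WM2_functional_limit M Z1 (batch_means_average m Z1) \<mu> h l N Y1 (batch_means_average m Y1)
    \<and> (AE \<omega> in N. continuous_on {0..} (\<lambda>t. batch_means_average m Y1 t \<omega>))
    \<and> functional_limit_condition M Z1 (batch_means_average m Z1) \<mu> h l
         N Y1 (batch_means_average m Y1)"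
proof -
  have Z: "D_process M Z1" "AE \<omega> in M. Z1 0 \<omega> = 0" and h: "0 < h" "h < 1"
    and l: "\<forall>\<^sub>F x in at_top. l x > 0" "slowly_varying l" and Y: "D_process N Y1"
    and conv: "weakly_converges M2_topology M (\<lambda>\<epsilon>. sample_path (scaled_centred \<mu> h l Z1 \<epsilon>))
      N (sample_path Y1) (at_right 0)"
    and growth: "AE \<omega> in M. ((\<lambda>t. (Z1 t \<omega> - \<mu> * t) / t) \<longlongrightarrow> 0) at_top"
    and law: "\<And>a. a > 0 \<Longrightarrow> process_law N (\<lambda>t. Y1 (a * t)) = process_law N (\<lambda>t \<omega>. a powr h * Y1 t \<omega>)"
    and qlc: "quasi_left_continuous N (augmented_natural_filtration N Y1) Y1"
    using assms(3) by (auto simp: marginal_limit_condition_def)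
  have m: "m \<ge> 1" using assms(4) by simp
  have Y0: "AE \<omega> in N. Y1 0 \<omega> = 0"
    by (rule self_similar_AE_zero_at_zero[OF assms(2) Y h(1) law])
  have limit: "WM2_functional_limit M Z1 (batch_means_average m Z1) \<mu> h l N Y1 (batch_means_average m Y1)"
    by (rule WM2_functional_limit_batch_means[OF conv Z(2) Y0 l(1) m])
  have cont: "AE \<omega> in N. continuous_on {0..} (\<lambda>t. batch_means_average m Y1 t \<omega>)"
    by (rule AE_continuous_batch_means_average[OF Y Y0])
  have "AE \<omega> in M. cadlag (\<lambda>t. Z1 t \<omega>)" using Z(1) by (simp add: D_process_def)
  with growth AE_batch_means_average[where X = Z1, OF Z(2), of m]
  have growth2: "AE \<omega> in M. ((\<lambda>t. batch_means_average m Z1 t \<omega> / t\<^sup>2) \<longlongrightarrow> 0) at_top"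
  proof eventually_elim
    case (elim \<omega>)
    show ?case
    proof (rule Lim_transform_eventually[OF batch_variance_over_square_tendsto_0[OF elim(3,1) m]])
      show "\<forall>\<^sub>F t in at_top. batch_variance m (\<lambda>t. Z1 t \<omega>) t / t\<^sup>2 = batch_means_average m Z1 t \<omega> / t\<^sup>2"
        using eventually_ge_at_top[of 0] by eventually_elim (use elim(2) in simp)
    qed
  qed
  have "AE \<omega> in N. \<forall>t\<ge>0. jump (\<lambda>t. batch_means_average m Y1 t \<omega>) t \<ge> 0"
    using cont by eventually_elim (simp add: jump_def left_lim_continuous)
  moreover have "AE \<omega> in N. \<forall>t>0. batch_means_average m Y1 t \<omega> > 0"
    by (rule AE_batch_means_average_positive[OF Y Y0 assms(4) law assms(5)])
  moreover have "\<forall>a>0. process_law N (\<lambda>t \<omega>. (Y1 (a * t) \<omega>, batch_means_average m Y1 (a * t) \<omega>))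
      = process_law N (\<lambda>t \<omega>. (a powr h * Y1 t \<omega>, a powr (2 * h) * batch_means_average m Y1 t \<omega>))"
    by (intro allI impI process_law_batch_means_self_similar[OF Y Y0 _ m law])
  ultimately have "functional_limit_condition M Z1 (batch_means_average m Z1) \<mu> h l
      N Y1 (batch_means_average m Y1)"
    unfolding functional_limit_condition_def augmented_natural_filtration_batch_means[OF Y Y0]
    using Z h l Y limit growth growth2 qlc D_plus_process_batch_means_average[OF Z m]
      D_plus_process_batch_means_average[OF Y Y0 m]
    by (intro conjI)
  with limit cont show ?thesis by blast
qed

end
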